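(* Let $L$ be an invariant $r\times m$ integer matrix of full rank $r$. Then for every $\alpha>0$ there exists $c=c(\alpha,L)>0$ such that every measurable set $A\subset\mathbb{T}$ with $\mu_{\mathbb{T}}(A)\ge\alpha$ satisfies $S_L(A)\ge c$.
   Context: $\mathbb{T}=\mathbb{R}/\mathbb{Z}$ with normalized Haar (Lebesgue) measure $\mu_{\mathbb{T}}$; "measurable" means Borel measurable. An integer matrix $L$ is invariant if $L\mathbf{1}=0$ where $\mathbf{1}=(1,\ldots,1)$. $\ker_{\mathbb{T}}L=\{x\in\mathbb{T}^m:Lx=0\}$ with normalized Haar probability measure $\mu_L$, and $S_L(A)=\mu_L\big(A^m\cap\ker_{\mathbb{T}}L\big)$. *)

theory Defs
  imports "HOL-Probability.Probability"
begin

text \<open>The circle T = R/Z is represented by the fundamental domain [0,1) of the reals;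
  T^m by [0,1)^m inside real^'m; addition in T^m is componentwise addition followed by
  taking fractional parts.\<close>

definition torus_pts :: "(real^'m) set" where
  "torus_pts = {x. \<forall>i. 0 \<le> x$i \<and> x$i < 1}"

definition tadd :: "real^'m \<Rightarrow> real^'m \<Rightarrow> real^'m" where
  "tadd x y = (\<chi> i. frac (x$i + y$i))"

definition kerT :: "real^'m^'r \<Rightarrow> (real^'m) set" where
  "kerT L = {x \<in> torus_pts. \<forall>j. (L *v x)$j \<in> \<int>}"

text \<open>M is (the) normalized Haar probability measure of the compact group ker_T L,
  viewed as a Borel measure on T^m concentrated on ker_T L: a probability measure
  on Borel sets, supported on ker_T L, invariant under translation by elements of ker_T L.\<close>
definition haar_kerT :: "real^'m^'r \<Rightarrow> (real^'m) measure \<Rightarrow> bool" where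
  "haar_kerT L M \<longleftrightarrow> prob_space M \<and> sets M = sets borel \<and>
     emeasure M (UNIV - kerT L) = 0 \<and>
     (\<forall>t \<in> kerT L. distr M borel (tadd t) = M)"

definition S_L :: "(real^'m) measure \<Rightarrow> real^'m^'r \<Rightarrow> real set \<Rightarrow> real" where
  "S_L M L A = measure M ({x. \<forall>i. x$i \<in> A} \<inter> kerT L)"

end

(* Density Hales-Jewett implies the theorem. Index the coordinates by k letters and draw
   Y_0, ..., Y_{n-1} independently from Haar measure on ker_T L. Send a word w of length n to
   the point frac (sum_j (Y_j)_{w_j}) of T. Each word is sent to a uniform point of T, because
   ker_T L contains the diagonal; and the k words of a combinatorial line are sent to the
   coordinates of a Haar-distributed point of ker_T L, because one Y_j with j a wildcard
   position already makes the common translate Haar. If A has density alpha, then with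
   probability bounded below the words sent to A have density alpha/2, so they contain a line;
   there are finitely many lines, so some of them, and hence S_L(A), is bounded below.

   Density Hales-Jewett is proved by a density increment in the style of Polymath and of
   Dodos, Kanellopoulos and Tyros. Let D be the supremum of the densities that line-free sets
   over k+1 letters attain in every dimension, and let A be line-free with density almost D.
   All its slices then have density almost D, so the theorem for k letters gives a set of
   positive density that is an intersection of k sets, the i-th insensitive to exchanging the
   letters i and k, and that A avoids. The complement of that set splits into such
   intersections, on one of which A is too dense; and these can be filled up to a small error
   by subspaces, on one of which A has density above D, a contradiction. *)

theory Submission
  imports Defs
begin

definition words :: "nat set \<Rightarrow> nat \<Rightarrow> nat list set" where
  "words B n = {w. set w \<subseteq> B \<and> length w = n}"

text \<open>In a template, \<open>Inl a\<close> is the fixed letter \<open>a\<close> and \<open>Inr j\<close> the \<open>j\<close>-th variable; a template in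
  \<open>d\<close> variables, each of which must occur, is a combinatorial subspace of dimension \<open>d\<close>, a line
  if \<open>d = 1\<close>.\<close>

definition subst :: "(nat + nat) list \<Rightarrow> nat list \<Rightarrow> nat list" where
  "subst t w = map (case_sum id (nth w)) t"

definition templates :: "nat set \<Rightarrow> nat \<Rightarrow> nat \<Rightarrow> (nat + nat) list set" where
  "templates B d n =
    {t. length t = n \<and> set t \<subseteq> Inl ` B \<union> Inr ` {..<d} \<and> Inr ` {..<d} \<subseteq> set t}"

text \<open>Only words over \<open>{..<k}\<close> of length \<open>n\<close> are counted, so
  \<open>A\<close> may be any set of lists, and its sections and pullbacks need not be cut down to a
  cube.\<close>

definition density_hj :: "nat \<Rightarrow> nat \<Rightarrow> real \<Rightarrow> nat \<Rightarrow> bool" where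
  "density_hj k d \<delta> n \<longleftrightarrow> (\<forall>A. (\<Sum>w\<in>words {..<k} n. of_bool (w \<in> A)) \<ge> \<delta> * real k ^ n \<longrightarrow>
     (\<exists>t\<in>templates {..<k} d n. \<forall>v\<in>words {..<k} d. subst t v \<in> A))"

subsection \<open>Words and sums over words\<close>

lemma finite_words [simp]: "finite B \<Longrightarrow> finite (words B n)"
  unfolding words_def by (rule finite_lists_length_eq)

lemma card_words: "finite B \<Longrightarrow> card (words B n) = card B ^ n"
  unfolding words_def by (rule card_lists_length_eq)

lemma words_0 [simp]: "words B 0 = {[]}"
  by (auto simp: words_def)

lemma length_words: "w \<in> words B n \<Longrightarrow> length w = n"
  by (simp add: words_def)

lemma words_mono: "B \<subseteq> C \<Longrightarrow> words B n \<subseteq> words C n"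
  by (auto simp: words_def)

lemma nth_words: "w \<in> words B n \<Longrightarrow> j < n \<Longrightarrow> w ! j \<in> B"
  by (auto simp: words_def)

lemma sum_words_append:
  "(\<Sum>w\<in>words B (m + n). f w) = (\<Sum>x\<in>words B m. \<Sum>y\<in>words B n. f (x @ y))"
proof -
  have "(\<Sum>x\<in>words B m. \<Sum>y\<in>words B n. f (x @ y)) = (\<Sum>(x, y)\<in>words B m \<times> words B n. f (x @ y))"
    by (rule sum.cartesian_product)
  also have "\<dots> = (\<Sum>w\<in>words B (m + n). f w)"
    by (rule sum.reindex_bij_witness[where i = "\<lambda>w. (take m w, drop m w)" and j = "\<lambda>(x, y). x @ y"])
      (auto simp: words_def dest: in_set_takeD in_set_dropD)
  finally show ?thesis ..
qed

lemma sum_words_Suc: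
  "(\<Sum>w\<in>words B (Suc n). f w) = (\<Sum>a\<in>B. \<Sum>w\<in>words B n. f (a # w))"
proof -
  have "(\<Sum>a\<in>B. \<Sum>w\<in>words B n. f (a # w)) = (\<Sum>(a, w)\<in>B \<times> words B n. f (a # w))"
    by (rule sum.cartesian_product)
  also have "\<dots> = (\<Sum>w\<in>words B (Suc n). f w)"
    by (rule sum.reindex_bij_witness[where i = "\<lambda>w. (hd w, tl w)" and j = "\<lambda>(a, w). a # w"])
      (auto simp: words_def length_Suc_conv)
  finally show ?thesis ..
qed

section \<open>Averaging and pigeonhole\<close>

lemma exists_ge_average:
  fixes g :: "'a \<Rightarrow> real"
  assumes "finite P" "0 < a" "a \<le> sum g P"
  obtains p where "p \<in> P" "a / real (card P) \<le> g p"
proof -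
  have "P \<noteq> {}" using assms by auto
  then have c: "0 < real (card P)" using assms by (simp add: card_gt_0_iff)
  have "\<exists>p\<in>P. a / real (card P) \<le> g p"
  proof (rule ccontr)
    assume "\<not> ?thesis"
    then have "sum g P < (\<Sum>p\<in>P. a / real (card P))"
      using assms(1) \<open>P \<noteq> {}\<close> by (intro sum_strict_mono) auto
    also have "\<dots> = a" using c by simp
    finally show False using assms by simp
  qed
  then show ?thesis using that by blast
qed

lemma of_bool_le_sum:
  assumes "finite P" "p \<in> P" "Q p"
  shows "(1::real) \<le> (\<Sum>p\<in>P. of_bool (Q p))"
proof -
  have "(\<Sum>p\<in>{p}. of_bool (Q p)) \<le> (\<Sum>p\<in>P. of_bool (Q p) :: real)"
    using assms by (intro sum_mono2) auto
  then show ?thesis using assms by simp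
qed

text \<open>A fibre \<open>{x. Q x y}\<close> of density at least \<delta> contains some
  \<open>R p\<close>. Total density \<open>2 * \<delta>\<close> forces this for a proportion at
  least \<delta> of all \<open>y\<close>, and some \<open>p\<close> serves its share of them. The
  \<open>+ 1\<close> keeps the constant positive even before \<open>P\<close> is known to be
  nonempty.\<close>

lemma density_pigeonhole:
  fixes Q :: "'x \<Rightarrow> 'y \<Rightarrow> bool" and R :: "'p \<Rightarrow> 'x set"
  assumes fin: "finite X" "finite Y" "finite P" and ne: "X \<noteq> {}" "Y \<noteq> {}" and "0 < \<delta>"
    and pat: "\<And>B. (\<Sum>x\<in>X. of_bool (x \<in> B)) \<ge> \<delta> * real (card X) \<Longrightarrow> \<exists>p\<in>P. R p \<subseteq> B"
    and dense: "(\<Sum>x\<in>X. \<Sum>y\<in>Y. of_bool (Q x y)) \<ge> 2 * \<delta> * real (card X) * real (card Y)"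
  obtains p where "p \<in> P"
    "(\<Sum>y\<in>Y. of_bool (\<forall>x\<in>R p. Q x y)) \<ge> \<delta> / (real (card P) + 1) * real (card Y)"
proof -
  have X: "0 < real (card X)" and Y: "0 < real (card Y)" using fin ne by (auto simp: card_gt_0_iff)
  have pt: "(\<Sum>x\<in>X. of_bool (Q x y)) \<le>
      \<delta> * real (card X) + real (card X) * (\<Sum>p\<in>P. of_bool (\<forall>x\<in>R p. Q x y))" for y
  proof (cases "(\<Sum>x\<in>X. of_bool (x \<in> {x. Q x y})) \<ge> \<delta> * real (card X)")
    case True
    from pat[OF this] obtain p where p: "p \<in> P" "\<forall>x\<in>R p. Q x y" by auto
    have 1: "1 \<le> (\<Sum>p\<in>P. of_bool (\<forall>x\<in>R p. Q x y) :: real)"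
      by (rule of_bool_le_sum[where Q = "\<lambda>p. \<forall>x\<in>R p. Q x y", OF fin(3) p])
    have "(\<Sum>x\<in>X. of_bool (Q x y)) \<le> (\<Sum>x\<in>X. 1 :: real)" by (intro sum_mono) auto
    also have "\<dots> = real (card X)" by simp
    also have "\<dots> \<le> real (card X) * (\<Sum>p\<in>P. of_bool (\<forall>x\<in>R p. Q x y))"
      using mult_left_mono[OF 1, of "real (card X)"] by simp
    finally show ?thesis using X \<open>0 < \<delta>\<close> by (smt (verit) mult_pos_pos)
  next
    case False
    moreover have "0 \<le> real (card X) * (\<Sum>p\<in>P. of_bool (\<forall>x\<in>R p. Q x y))"
      by (intro mult_nonneg_nonneg sum_nonneg) auto
    ultimately show ?thesis by simp
  qed
  have "2 * \<delta> * real (card X) * real (card Y) \<le> (\<Sum>y\<in>Y. \<Sum>x\<in>X. of_bool (Q x y))"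
    using dense by (subst sum.swap)
  also have "\<dots> \<le> (\<Sum>y\<in>Y. \<delta> * real (card X) + real (card X) * (\<Sum>p\<in>P. of_bool (\<forall>x\<in>R p. Q x y)))"
    by (intro sum_mono pt)
  also have "\<dots> = \<delta> * real (card X) * real (card Y) +
      real (card X) * (\<Sum>y\<in>Y. \<Sum>p\<in>P. of_bool (\<forall>x\<in>R p. Q x y))"
    by (simp add: sum.distrib sum_distrib_left)
  finally have "real (card X) * (\<delta> * real (card Y)) \<le>
      real (card X) * (\<Sum>y\<in>Y. \<Sum>p\<in>P. of_bool (\<forall>x\<in>R p. Q x y))"
    by (simp add: algebra_simps)
  then have "\<delta> * real (card Y) \<le> (\<Sum>y\<in>Y. \<Sum>p\<in>P. of_bool (\<forall>x\<in>R p. Q x y))"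
    using X by (simp only: mult_le_cancel_left_pos)
  then have "\<delta> * real (card Y) \<le> (\<Sum>p\<in>P. \<Sum>y\<in>Y. of_bool (\<forall>x\<in>R p. Q x y))"
    by (subst sum.swap)
  from exists_ge_average[OF fin(3) _ this] obtain p where
    "p \<in> P" "\<delta> * real (card Y) / real (card P) \<le> (\<Sum>y\<in>Y. of_bool (\<forall>x\<in>R p. Q x y))"
    using Y \<open>0 < \<delta>\<close> by auto
  moreover have "\<delta> / (real (card P) + 1) * real (card Y) \<le> \<delta> * real (card Y) / real (card P)"
  proof -
    have "0 < real (card P)" using \<open>p \<in> P\<close> fin by (auto simp: card_gt_0_iff)
    then show ?thesis using Y \<open>0 < \<delta>\<close> by (simp add: frac_le)
  qed
  ultimately show ?thesis using that by fastforce
qed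

subsection \<open>Templates\<close>

lemma finite_templates [simp]: "finite B \<Longrightarrow> finite (templates B d n)"
  by (rule finite_subset[OF _ finite_lists_length_eq[of "Inl ` B \<union> Inr ` {..<d}" n]])
    (auto simp: templates_def)

lemma templates_mono: "B \<subseteq> C \<Longrightarrow> templates B d n \<subseteq> templates C d n"
  unfolding templates_def by blast

lemma subst_append [simp]: "subst (t @ s) v = subst t v @ subst s v"
  by (simp add: subst_def)

lemma subst_Inl [simp]: "subst (map Inl x) v = x"
  by (simp add: subst_def o_def)

lemma length_subst [simp]: "length (subst t v) = length t"
  by (simp add: subst_def)

lemma subst_in_words:
  assumes "t \<in> templates B d n" "v \<in> words B d" shows "subst t v \<in> words B n"
proof -
  have "case_sum id (nth v) s \<in> B" if "s \<in> set t" for s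
  proof -
    have "s \<in> Inl ` B \<union> Inr ` {..<d}" using assms that by (auto simp: templates_def)
    then show ?thesis using nth_words[OF assms(2)] by auto
  qed
  then show ?thesis using assms by (auto simp: words_def templates_def subst_def)
qed

definition compose :: "(nat + nat) list \<Rightarrow> (nat + nat) list \<Rightarrow> (nat + nat) list" where
  "compose t s = map (case_sum Inl (nth s)) t"

lemma compose_templates:
  assumes t: "t \<in> templates B d n" and s: "s \<in> templates B e d"
  shows "compose t s \<in> templates B e n"
proof -
  have st: "set t \<subseteq> Inl ` B \<union> Inr ` {..<d}" "Inr ` {..<d} \<subseteq> set t" "length t = n"
    and ss: "set s \<subseteq> Inl ` B \<union> Inr ` {..<e}" "Inr ` {..<e} \<subseteq> set s" "length s = d"
    using t s by (auto simp: templates_def)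
  have "case_sum Inl (nth s) z \<in> Inl ` B \<union> Inr ` {..<e}" if "z \<in> set t" for z
  proof -
    from that st have "z \<in> Inl ` B \<union> Inr ` {..<d}" by blast
    then show ?thesis
    proof
      assume "z \<in> Inr ` {..<d}"
      then obtain j where j: "z = Inr j" "j < d" by auto
      then have "s ! j \<in> set s" using ss by simp
      then have "s ! j \<in> Inl ` B \<union> Inr ` {..<e}" using ss(1) by blast
      then show ?thesis using j by simp
    qed auto
  qed
  moreover have "Inr j \<in> set (compose t s)" if "j < e" for j
  proof -
    have "Inr j \<in> set s" using ss that by blast
    then obtain i where "i < d" "s ! i = Inr j" using ss by (auto simp: in_set_conv_nth)
    moreover have "Inr i \<in> set t" using st \<open>i < d\<close> by blast
    ultimately show ?thesis unfolding compose_def by (force intro!: image_eqI[where x = "Inr i"])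
  qed
  ultimately show ?thesis using st unfolding templates_def compose_def by auto
qed

lemma subst_compose:
  assumes "t \<in> templates B d n" "s \<in> templates C e d"
  shows "subst (compose t s) v = subst t (subst s v)"
proof -
  have "case_sum id (nth v) (case_sum Inl (nth s) z) = case_sum id (nth (subst s v)) z"
    if "z \<in> set t" for z
  proof -
    have "z \<in> Inl ` B \<union> Inr ` {..<d}" "length s = d" using assms that by (auto simp: templates_def)
    then show ?thesis by (auto simp: subst_def)
  qed
  then show ?thesis unfolding subst_def[of _ v] subst_def[of t] compose_def by simp
qed

lemma Inl_append_templates:
  assumes "t \<in> templates B d n" "x \<in> words B m"
  shows "map Inl x @ t \<in> templates B d (m + n)"
  using assms by (auto simp: templates_def words_def)

lemma append_Inl_templates:
  assumes "t \<in> templates B d n" "x \<in> words B m"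
  shows "t @ map Inl x \<in> templates B d (n + m)"
  using assms by (auto simp: templates_def words_def)

lemma identity_template:
  obtains t where "t \<in> templates B d d" "\<And>v. v \<in> words B d \<Longrightarrow> subst t v = v"
proof
  show "map Inr [0..<d] \<in> templates B d d" by (auto simp: templates_def)
  show "subst (map Inr [0..<d]) v = v" if "v \<in> words B d" for v
    using that by (auto simp: subst_def o_def words_def map_nth)
qed

lemma subst_Inr_Suc [simp]: "subst (map (map_sum id Suc) s) (a # v) = subst s v"
  by (auto simp: subst_def split: sum.split)

text \<open>The product of a line and a subspace: variable 0 drives \<open>t\<close>, and the
  variables of \<open>s\<close> are shifted past it.\<close>

lemma stack_templates:
  assumes t: "t \<in> templates B 1 m" and s: "s \<in> templates B d n"
  shows "t @ map (map_sum id Suc) s \<in> templates B (Suc d) (m + n)"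
proof -
  have t': "set t \<subseteq> Inl ` B \<union> Inr ` {..<1}" "Inr ` {..<1} \<subseteq> set t" "length t = m"
    and s': "set s \<subseteq> Inl ` B \<union> Inr ` {..<d}" "Inr ` {..<d} \<subseteq> set s" "length s = n"
    using t s by (auto simp: templates_def)
  have "map_sum id Suc z \<in> Inl ` B \<union> Inr ` {..<Suc d}" if "z \<in> set s" for z
  proof -
    have "z \<in> Inl ` B \<union> Inr ` {..<d}" using that s' by blast
    then show ?thesis by auto
  qed
  moreover have "Inr j \<in> set t \<union> map_sum id Suc ` set s" if "j < Suc d" for j
  proof (cases j)
    case (Suc i)
    then have "Inr i \<in> set s" using s' that by auto
    then show ?thesis using Suc by (force intro!: image_eqI[where x = "Inr i"])
  qed (use t' in auto)
  moreover have "set t \<subseteq> Inl ` B \<union> Inr ` {..<Suc d}" using t'(1) by auto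
  ultimately have "set (t @ map (map_sum id Suc) s) \<subseteq> Inl ` B \<union> Inr ` {..<Suc d}"
    "Inr ` {..<Suc d} \<subseteq> set (t @ map (map_sum id Suc) s)"
    by (auto simp: image_subset_iff)
  then show ?thesis using t' s' by (simp add: templates_def)
qed

lemma subst_line_Cons:
  assumes "t \<in> templates B 1 m" shows "subst t (a # v) = subst t [a]"
proof -
  have "z \<in> Inl ` B \<union> Inr ` {..<1}" if "z \<in> set t" for z using assms that by (auto simp: templates_def)
  then have "case_sum id (nth (a # v)) z = case_sum id (nth [a]) z" if "z \<in> set t" for z
    using that by (fastforce simp: image_iff)
  then show ?thesis by (simp add: subst_def)
qed

subsection \<open>Uniform subcubes of a uniform word\<close>

fun overwrite :: "nat set \<Rightarrow> nat list \<Rightarrow> nat list \<Rightarrow> nat list" where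
  "overwrite J [] u = []"
| "overwrite J (a # z) [] = a # z"
| "overwrite J (a # z) (b # u) = (if a \<in> J then b # overwrite J z u else a # overwrite J z (b # u))"

lemma overwrite_Nil [simp]: "overwrite J z [] = z"
  by (cases z) auto

text \<open>Overwriting the first \<open>m\<close> letters from \<open>J\<close> by independent uniform letters of \<open>J\<close> does not
  change the distribution of a uniform word. Hence a uniform word is a mixture of uniform points of
  subcubes, up to the rare words with fewer than \<open>m\<close> letters from \<open>J\<close>.\<close>

lemma sum_overwrite:
  fixes f :: "nat list \<Rightarrow> real"
  assumes "finite B" "J \<subseteq> B"
  shows "(\<Sum>z\<in>words B n. \<Sum>u\<in>words J m. f (overwrite J z u)) =
    real (card J) ^ m * (\<Sum>z\<in>words B n. f z)"
proof (induction n arbitrary: m f)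
  case 0
  have "finite J" using assms finite_subset by blast
  then show ?case by (simp add: card_words)
next
  case (Suc n)
  have J: "finite J" using assms finite_subset by blast
  show ?case
  proof (cases m)
    case 0
    then show ?thesis by simp
  next
    case m: (Suc m')
    \<comment> \<open>A first letter from \<open>J\<close> is replaced by an independent
      \<open>b\<close>; summing over the forgotten \<open>a\<close> in \<open>J\<close> supplies the
      factor \<open>card J\<close> that \<open>m'\<close> lacks against \<open>m\<close>.\<close>
    have 1: "(\<Sum>z\<in>words B n. \<Sum>u\<in>words J m. f (overwrite J (a # z) u)) =
       real (card J) ^ m' * (\<Sum>b\<in>J. \<Sum>z\<in>words B n. f (b # z))" if "a \<in> J" for a
    proof -
      have "(\<Sum>z\<in>words B n. \<Sum>u\<in>words J m. f (overwrite J (a # z) u)) =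
          (\<Sum>z\<in>words B n. \<Sum>b\<in>J. \<Sum>u\<in>words J m'. f (b # overwrite J z u))"
        using that by (simp add: m sum_words_Suc)
      also have "\<dots> = (\<Sum>b\<in>J. \<Sum>z\<in>words B n. \<Sum>u\<in>words J m'. f (b # overwrite J z u))"
        by (rule sum.swap)
      also have "\<dots> = (\<Sum>b\<in>J. real (card J) ^ m' * (\<Sum>z\<in>words B n. f (b # z)))"
        by (intro sum.cong refl Suc.IH[where f = "\<lambda>z. f (_ # z)"])
      finally show ?thesis by (simp add: sum_distrib_left)
    qed
    have 2: "(\<Sum>z\<in>words B n. \<Sum>u\<in>words J m. f (overwrite J (a # z) u)) =
       real (card J) ^ m * (\<Sum>z\<in>words B n. f (a # z))" if "a \<notin> J" for a
    proof -
      have "(\<Sum>z\<in>words B n. \<Sum>u\<in>words J m. f (overwrite J (a # z) u)) =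
          (\<Sum>z\<in>words B n. \<Sum>u\<in>words J m. f (a # overwrite J z u))"
      proof (intro sum.cong refl)
        fix z u assume "u \<in> words J m"
        then obtain b u' where "u = b # u'" using m by (auto simp: words_def length_Suc_conv)
        then show "f (overwrite J (a # z) u) = f (a # overwrite J z u)" using that by simp
      qed
      also have "\<dots> = real (card J) ^ m * (\<Sum>z\<in>words B n. f (a # z))"
        by (rule Suc.IH[where f = "\<lambda>z. f (a # z)"])
      finally show ?thesis .
    qed
    have split: "(\<Sum>a\<in>B. g a) = (\<Sum>a\<in>J. g a) + (\<Sum>a\<in>B - J. g a)" for g :: "nat \<Rightarrow> real"
      using sum.subset_diff[OF assms(2,1), of g] by simp
    have "(\<Sum>z\<in>words B (Suc n). \<Sum>u\<in>words J m. f (overwrite J z u)) =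
        (\<Sum>a\<in>J. real (card J) ^ m' * (\<Sum>b\<in>J. \<Sum>z\<in>words B n. f (b # z))) +
        (\<Sum>a\<in>B - J. real (card J) ^ m * (\<Sum>z\<in>words B n. f (a # z)))"
      unfolding sum_words_Suc[of _ B n] split by (intro arg_cong2[of _ _ _ _ "(+)"] sum.cong refl) (auto simp: 1 2)
    also have "\<dots> = real (card J) ^ m * ((\<Sum>b\<in>J. \<Sum>z\<in>words B n. f (b # z)) +
        (\<Sum>a\<in>B - J. \<Sum>z\<in>words B n. f (a # z)))"
      by (simp add: m sum_distrib_left algebra_simps)
    also have "\<dots> = real (card J) ^ m * (\<Sum>z\<in>words B (Suc n). f z)"
      unfolding sum_words_Suc split ..
    finally show ?thesis .
  qed
qed

text \<open>The subcube through \<open>z\<close> along which \<open>overwrite\<close> moves. The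
  counter \<open>s\<close> is the number of the next variable, and each variable is placed at most
  once.\<close>

fun mark :: "nat set \<Rightarrow> nat \<Rightarrow> nat \<Rightarrow> nat list \<Rightarrow> (nat + nat) list" where
  "mark J s e [] = []"
| "mark J s e (a # z) =
    (if a \<in> J \<and> s < e then Inr s # mark J (Suc s) e z else Inl a # mark J s e z)"

lemma mark_exhausted: "mark J e e z = map Inl z"
  by (induction z) auto

lemma subst_mark:
  "length u = e \<Longrightarrow> s \<le> e \<Longrightarrow> subst (mark J s e z) u = overwrite J z (drop s u)"
proof (induction z arbitrary: s)
  case (Cons a z)
  show ?case
  proof (cases "s = e")
    case True
    then show ?thesis using Cons.prems by (simp only: mark_exhausted subst_Inl) (simp add: overwrite_Nil)
  next
    case False
    then have "drop s u = u ! s # drop (Suc s) u" using Cons.prems by (simp add: Cons_nth_drop_Suc)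
    then show ?thesis using Cons.IH[of s] Cons.IH[of "Suc s"] Cons.prems False
      by (auto simp: subst_def)
  qed
qed (simp add: subst_def)

lemma set_mark: "set (mark J s e z) \<subseteq> Inl ` set z \<union> Inr ` {..<e}"
  by (induction J s e z rule: mark.induct) auto

lemma length_mark [simp]: "length (mark J s e z) = length z"
  by (induction J s e z rule: mark.induct) auto

lemma Inr_mark:
  "e \<le> s + length (filter (\<lambda>a. a \<in> J) z) \<Longrightarrow> s \<le> j \<Longrightarrow> j < e \<Longrightarrow> Inr j \<in> set (mark J s e z)"
proof (induction z arbitrary: s)
  case (Cons a z)
  show ?case
  proof (cases "a \<in> J")
    case True
    then show ?thesis using Cons.IH[of "Suc s"] Cons.prems by (cases "j = s") auto
  next
    case False
    then show ?thesis using Cons.IH[of s] Cons.prems by auto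
  qed
qed auto

lemma mark_templates:
  assumes "z \<in> words B n" "e \<le> length (filter (\<lambda>a. a \<in> J) z)"
  shows "mark J 0 e z \<in> templates B e n"
proof -
  have "Inl ` set z \<subseteq> Inl ` B" using assms by (auto simp: words_def)
  then have "set (mark J 0 e z) \<subseteq> Inl ` B \<union> Inr ` {..<e}" using set_mark[of J 0 e z] by blast
  moreover have "Inr ` {..<e} \<subseteq> set (mark J 0 e z)" using Inr_mark[of e 0 J z] assms by auto
  ultimately show ?thesis using assms by (simp add: templates_def words_def)
qed

lemma sum_half_power_filter:
  assumes "finite B" "J \<subseteq> B"
  shows "(\<Sum>z\<in>words B n. (1/2 :: real) ^ length (filter (\<lambda>a. a \<in> J) z)) =
    (real (card B) - real (card J) / 2) ^ n"
proof (induction n)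
  case (Suc n)
  let ?S = "\<Sum>z\<in>words B n. (1/2 :: real) ^ length (filter (\<lambda>a. a \<in> J) z)"
  have J: "finite J" using assms finite_subset by blast
  have "(\<Sum>z\<in>words B (Suc n). (1/2 :: real) ^ length (filter (\<lambda>a. a \<in> J) z)) =
      (\<Sum>a\<in>B. (if a \<in> J then 1/2 else 1) * ?S)"
    unfolding sum_words_Suc by (intro sum.cong) (auto simp: sum_distrib_left)
  also have "\<dots> = (\<Sum>a\<in>B. (1 - of_bool (a \<in> J) / 2)) * ?S"
    unfolding sum_distrib_right by (intro sum.cong) auto
  also have "(\<Sum>a\<in>B. (1 - of_bool (a \<in> J) / 2)) = real (card B) - (\<Sum>a\<in>B. of_bool (a \<in> J)) / 2"
    by (simp add: sum_subtractf sum_divide_distrib)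
  also have "(\<Sum>a\<in>B. of_bool (a \<in> J)) = real (card J)"
    using assms by (simp add: of_bool_def sum.If_cases Int_absorb1 Int_def[symmetric])
  finally show ?case using Suc by simp
qed simp

text \<open>The number of letters from \<open>J\<close> in a uniform word is binomial with success
  probability \<open>q / b\<close>, so it falls below the fixed \<open>e\<close> with probability
  tending to 0. The length depends on \<open>J\<close> only through its size, since \<open>J\<close>
  is known only later.\<close>

lemma few_special_letters_rare:
  assumes "0 < \<epsilon>" "0 < q" "q \<le> b"
  obtains n where "\<And>B J. finite B \<Longrightarrow> card B = b \<Longrightarrow> J \<subseteq> B \<Longrightarrow> card J = q \<Longrightarrow>
    (\<Sum>z\<in>words B n. of_bool (length (filter (\<lambda>a. a \<in> J) z) < e)) \<le> \<epsilon> * real b ^ n"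
proof -
  define r where "r = 1 - real q / (2 * real b)"
  have r: "0 \<le> r" "r < 1" using assms by (auto simp: r_def field_simps)
  then obtain n where n: "r ^ n < \<epsilon> / 2 ^ e"
    using real_arch_pow_inv[of "\<epsilon> / 2 ^ e" r] assms by auto
  show ?thesis
  proof (rule that)
    fix B J :: "nat set" assume B: "finite B" "card B = b" "J \<subseteq> B" "card J = q"
    \<comment> \<open>exponential Markov inequality\<close>
    have le: "of_bool (length (filter (\<lambda>a. a \<in> J) z) < e) \<le>
        (2::real) ^ e * (1/2) ^ length (filter (\<lambda>a. a \<in> J) z)" for z
    proof (cases "length (filter (\<lambda>a. a \<in> J) z) < e")
      case True
      then have "(2::real) ^ length (filter (\<lambda>a. a \<in> J) z) \<le> 2 ^ e" by (intro power_increasing) auto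
      then show ?thesis by (simp add: power_one_over field_simps)
    qed auto
    have "(\<Sum>z\<in>words B n. of_bool (length (filter (\<lambda>a. a \<in> J) z) < e)) \<le>
        (\<Sum>z\<in>words B n. (2::real) ^ e * (1/2) ^ length (filter (\<lambda>a. a \<in> J) z))"
      by (intro sum_mono le)
    also have "\<dots> = 2 ^ e * (real b - real q / 2) ^ n"
      using sum_half_power_filter[OF B(1,3), of n] B by (simp add: sum_distrib_left[symmetric])
    also have "real b - real q / 2 = r * real b" using assms by (simp add: r_def field_simps)
    also have "2 ^ e * (r * real b) ^ n = (2 ^ e * r ^ n) * real b ^ n"
      by (simp add: power_mult_distrib)
    also have "\<dots> \<le> \<epsilon> * real b ^ n"
      using n by (intro mult_right_mono) (auto simp: field_simps)
    finally show "(\<Sum>z\<in>words B n. of_bool (length (filter (\<lambda>a. a \<in> J) z) < e)) \<le> \<epsilon> * real b ^ n" .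
  qed
qed

text \<open>By \<open>sum_overwrite\<close> the mean of \<open>f\<close> is the mean over
  \<open>z\<close> of its means over the subcubes through \<open>z\<close>. Words with too few
  letters from \<open>J\<close> to carry \<open>e\<close> variables account for at most half of
  \<open>\<theta> * F\<close>, so some other word has a subcube with at least the other
  half.\<close>

lemma dense_subcube:
  assumes "0 < \<theta>" "0 < q" "q \<le> b"
  obtains n where "\<And>B J f F. finite B \<Longrightarrow> card B = b \<Longrightarrow> J \<subseteq> B \<Longrightarrow> card J = q \<Longrightarrow> 0 < F \<Longrightarrow>
    (\<And>z. 0 \<le> f z \<and> f z \<le> F) \<Longrightarrow> \<theta> * F * real b ^ n \<le> (\<Sum>z\<in>words B n. f z) \<Longrightarrow>
    \<exists>t\<in>templates B e n. \<theta> / 2 * F * real q ^ e \<le> (\<Sum>u\<in>words J e. f (subst t u))"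
proof -
  obtain n where n: "\<And>B J. finite B \<Longrightarrow> card B = b \<Longrightarrow> J \<subseteq> B \<Longrightarrow> card J = q \<Longrightarrow>
    (\<Sum>z\<in>words B n. of_bool (length (filter (\<lambda>a. a \<in> J) z) < e)) \<le> \<theta> / 2 * real b ^ n"
    using few_special_letters_rare[of "\<theta> / 2" q b e] assms by auto
  show ?thesis
  proof (rule that)
    fix B J :: "nat set" and f F
    assume B: "finite B" "card B = b" "J \<subseteq> B" "card J = q" and F: "(0::real) < F"
      and f: "\<And>z. 0 \<le> f z \<and> f z \<le> F" and dense: "\<theta> * F * real b ^ n \<le> (\<Sum>z\<in>words B n. f z)"
    define good where "good z \<longleftrightarrow> e \<le> length (filter (\<lambda>a. a \<in> J) z)" for z
    define g where "g z = (\<Sum>u\<in>words J e. f (overwrite J z u))" for z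
    have J: "finite J" using B finite_subset by blast
    have gle: "g z \<le> F * real q ^ e" for z
      using sum_bounded_above[of "words J e" "\<lambda>u. f (overwrite J z u)" F] f J B
      by (simp add: g_def card_words algebra_simps)
    have g0: "0 \<le> g z" for z unfolding g_def using f by (intro sum_nonneg) auto
    have b: "0 < real b" and q: "0 < real q" using assms by auto
    have "\<exists>z\<in>words B n. good z \<and> \<theta> / 2 * F * real q ^ e \<le> g z"
    proof (rule ccontr)
      assume neg: "\<not> ?thesis"
      have pt: "g z \<le> \<theta> / 2 * F * real q ^ e + F * real q ^ e * of_bool (\<not> good z)" 
        if "z \<in> words B n" for z
        using neg that gle[of z] F assms(1) by (cases "good z") (auto simp: not_le intro: add_increasing)
      \<comment> \<open>A single good word makes the comparison of sums below strict. If there were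
        none, rarity of bad words would give \<open>2 \<le> \<theta>\<close>, while
        \<open>f \<le> F\<close> gives \<open>\<theta> \<le> 1\<close>.\<close>
      obtain z0 where z0: "z0 \<in> words B n" "good z0"
      proof -
        have "\<exists>z0\<in>words B n. good z0"
        proof (rule ccontr)
          assume "\<not> ?thesis"
          then have "(\<Sum>z\<in>words B n. of_bool (length (filter (\<lambda>a. a \<in> J) z) < e)) =
            (\<Sum>z\<in>words B n. 1 :: real)" by (intro sum.cong) (auto simp: good_def)
          also have "\<dots> = real b ^ n" using B by (simp add: card_words)
          finally have "1 * real b ^ n \<le> \<theta> / 2 * real b ^ n" using n[OF B] by simp
          then have "2 \<le> \<theta>" using b by (simp only: mult_le_cancel_right) simp
          have "(\<Sum>z\<in>words B n. f z) \<le> F * real b ^ n"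
            using sum_bounded_above[of "words B n" f F] f B by (simp add: card_words algebra_simps)
          then have "\<theta> * (F * real b ^ n) \<le> 1 * (F * real b ^ n)" using dense by simp
          moreover have "0 < F * real b ^ n" using F b by simp
          ultimately show False using \<open>2 \<le> \<theta>\<close> by (simp only: mult_le_cancel_right) simp
        qed
        then show ?thesis using that by blast
      qed
      have "real q ^ e * (\<theta> * F * real b ^ n) \<le> real q ^ e * (\<Sum>z\<in>words B n. f z)"
        using dense by (intro mult_left_mono) auto
      also have "\<dots> = (\<Sum>z\<in>words B n. g z)"
        unfolding g_def using sum_overwrite[OF B(1,3), of f e n] B by simp
      also have "\<dots> < (\<Sum>z\<in>words B n. \<theta> / 2 * F * real q ^ e + F * real q ^ e * of_bool (\<not> good z))"
      proof (rule sum_strict_mono_ex1)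
        show "\<exists>a\<in>words B n. g a < \<theta> / 2 * F * real q ^ e + F * real q ^ e * of_bool (\<not> good a)"
          using z0 neg by (intro bexI[of _ z0]) auto
      qed (use B pt in auto)
      also have "\<dots> = \<theta> / 2 * F * real q ^ e * real b ^ n +
          F * real q ^ e * (\<Sum>z\<in>words B n. of_bool (length (filter (\<lambda>a. a \<in> J) z) < e))"
        using B by (simp add: sum.distrib sum_distrib_left card_words good_def not_le)
      also have "\<dots> \<le> \<theta> / 2 * F * real q ^ e * real b ^ n + F * real q ^ e * (\<theta> / 2 * real b ^ n)"
        using n[OF B] F by (intro add_left_mono mult_left_mono) auto
      finally show False by (simp add: algebra_simps)
    qed
    then obtain z where z: "z \<in> words B n" "good z" "\<theta> / 2 * F * real q ^ e \<le> g z" by auto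
    have "g z = (\<Sum>u\<in>words J e. f (subst (mark J 0 e z) u))"
      unfolding g_def by (intro sum.cong) (auto simp: subst_mark words_def)
    then show "\<exists>t\<in>templates B e n. \<theta> / 2 * F * real q ^ e \<le> (\<Sum>u\<in>words J e. f (subst t u))"
      using z mark_templates[OF z(1), of e J] by (auto simp: good_def)
  qed
qed

subsection \<open>Multidimensional density Hales-Jewett\<close>

text \<open>Induction on \<open>d\<close>. Pigeonhole fixes one line in the first \<open>m\<close>
  positions that lies in \<open>A\<close> for a positive density of tails; the set of these tails
  contains a subspace of dimension \<open>d\<close> by induction, and the line is stacked on
  it.\<close>

lemma density_hj_multidim:
  assumes line: "\<forall>\<delta>>0. \<exists>n. density_hj k 1 \<delta> n" and "0 < k"
  shows "\<forall>\<delta>>0. \<exists>n. density_hj k d \<delta> n"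
proof (intro allI impI)
  show "0 < \<delta> \<Longrightarrow> \<exists>n. density_hj k d \<delta> n" for \<delta>
  proof (induction d arbitrary: \<delta>)
    case 0
    have "density_hj k 0 \<delta> 0"
      unfolding density_hj_def using 0 by (auto simp: templates_def subst_def of_bool_def split: if_splits)
    then show ?case ..
  next
    case (Suc d)
    obtain m where m: "density_hj k 1 (\<delta> / 2) m" using line Suc.prems by (meson half_gt_zero)
    define P where "P = templates {..<k} 1 m"
    define \<delta>' where "\<delta>' = \<delta> / 2 / (real (card P) + 1)"
    have "0 < \<delta>'" using Suc.prems by (simp add: \<delta>'_def)
    then obtain n where n: "density_hj k d \<delta>' n" using Suc.IH by blast
    have "density_hj k (Suc d) \<delta> (m + n)"
      unfolding density_hj_def
    proof (intro allI impI)
      fix A assume A: "\<delta> * real k ^ (m + n) \<le> (\<Sum>w\<in>words {..<k} (m + n). of_bool (w \<in> A))"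
      have ne: "words {..<k} j \<noteq> {}" for j
        using assms(2) card_words[of "{..<k}" j] by auto
      obtain t where t: "t \<in> P"
        "\<delta> / 2 / (real (card P) + 1) * real (card (words {..<k} n)) \<le>
          (\<Sum>y\<in>words {..<k} n. of_bool (\<forall>x\<in>subst t ` words {..<k} 1. x @ y \<in> A))"
      proof (rule density_pigeonhole[of "words {..<k} m" "words {..<k} n" P "\<delta> / 2"
            "\<lambda>t. subst t ` words {..<k} 1" "\<lambda>x y. x @ y \<in> A"])
        show "\<exists>p\<in>P. subst p ` words {..<k} 1 \<subseteq> B"
          if "\<delta> / 2 * real (card (words {..<k} m)) \<le> (\<Sum>x\<in>words {..<k} m. of_bool (x \<in> B))" for B
          using m that unfolding density_hj_def P_def by (force simp: card_words)
        show "2 * (\<delta> / 2) * real (card (words {..<k} m)) * real (card (words {..<k} n)) \<le>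
            (\<Sum>x\<in>words {..<k} m. \<Sum>y\<in>words {..<k} n. of_bool (x @ y \<in> A))"
          using A by (simp add: card_words sum_words_append power_add algebra_simps)
      qed (use Suc.prems ne in \<open>auto simp: P_def\<close>)
      then have "\<delta>' * real k ^ n \<le> (\<Sum>y\<in>words {..<k} n.
          of_bool (y \<in> {y. \<forall>x\<in>subst t ` words {..<k} 1. x @ y \<in> A}))"
        by (simp add: \<delta>'_def card_words)
      then obtain s where s: "s \<in> templates {..<k} d n"
        "\<forall>v\<in>words {..<k} d. subst s v \<in> {y. \<forall>x\<in>subst t ` words {..<k} 1. x @ y \<in> A}"
        using n unfolding density_hj_def by blast
      have "subst (t @ map (map_sum id Suc) s) v \<in> A" if v: "v \<in> words {..<k} (Suc d)" for v
      proof -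
        obtain a u where v': "v = a # u" "a < k" "u \<in> words {..<k} d"
          using v by (auto simp: words_def length_Suc_conv)
        have "[a] \<in> words {..<k} 1" using v' by (auto simp: words_def)
        then have "subst t [a] @ subst s u \<in> A" using s(2) v'(3) by blast
        then show ?thesis using v' subst_line_Cons[of t "{..<k}" m a u] t(1) by (simp add: P_def)
      qed
      then show "\<exists>t\<in>templates {..<k} (Suc d) (m + n). \<forall>v\<in>words {..<k} (Suc d). subst t v \<in> A"
        using stack_templates[of t "{..<k}" m s d n] t(1) s(1) unfolding P_def by blast
    qed
    then show ?case ..
  qed
qed

subsection \<open>Insensitive sets\<close>

definition demote :: "nat \<Rightarrow> nat \<Rightarrow> nat list \<Rightarrow> nat list" where
  "demote i k = map (\<lambda>a. if a = k then i else a)"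

text \<open>Membership depends only on the class of words with the same demotion. For
  \<open>i < k\<close> each class of words over \<open>k + 1\<close> letters has a representative
  over \<open>k\<close> letters, which is how the theorem for \<open>k\<close> letters gets
  applied.\<close>

definition insensitive :: "nat \<Rightarrow> nat \<Rightarrow> nat list set \<Rightarrow> bool" where
  "insensitive i k E \<longleftrightarrow> (\<forall>v w. demote i k v = demote i k w \<longrightarrow> (v \<in> E \<longleftrightarrow> w \<in> E))"

lemma demote_append [simp]: "demote i k (x @ y) = demote i k x @ demote i k y"
  by (simp add: demote_def)

lemma demote_idem [simp]: "demote i k (demote i k x) = demote i k x"
  by (simp add: demote_def)

lemma length_demote [simp]: "length (demote i k x) = length x"
  by (simp add: demote_def)

lemma demote_in_words: "i < k \<Longrightarrow> v \<in> words {..<Suc k} n \<Longrightarrow> demote i k v \<in> words {..<k} n"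
  by (force simp: words_def demote_def)

lemma demote_subst_cong:
  assumes "t \<in> templates B d n" "length v = d" "demote i k v = demote i k w"
  shows "demote i k (subst t v) = demote i k (subst t w)"
proof -
  let ?r = "\<lambda>a. if a = k then i else a"
  have len: "length w = d" using assms(2,3) by (metis length_demote)
  have "?r (case_sum id (nth v) z) = ?r (case_sum id (nth w) z)" if "z \<in> set t" for z
  proof -
    have "z \<in> Inl ` B \<union> Inr ` {..<d}" using assms(1) that by (auto simp: templates_def)
    then show ?thesis
    proof
      assume "z \<in> Inr ` {..<d}"
      then obtain j where j: "z = Inr j" "j < d" by auto
      have "demote i k v ! j = demote i k w ! j" using assms(3) by simp
      then have "?r (v ! j) = ?r (w ! j)" using j len assms(2) by (simp add: demote_def)
      then show ?thesis unfolding j(1) by (simp only: sum.case)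
    qed auto
  qed
  then show ?thesis unfolding demote_def subst_def map_map by (intro map_cong refl) simp
qed

text \<open>Exchanging \<open>i\<close> and \<open>k\<close> at places of \<open>v\<close> does the
  same at places of its image. The length is fixed because \<open>nth\<close> past the end of a list
  is not controlled by \<open>demote\<close>.\<close>

lemma insensitive_subst:
  assumes "t \<in> templates B d n" "insensitive i k E"
  shows "insensitive i k {v. length v = d \<and> subst t v \<in> E}"
  using assms demote_subst_cong[OF assms(1)] unfolding insensitive_def
  by (smt (verit) length_demote mem_Collect_eq)

lemma inj_on_subst:
  assumes "t \<in> templates B d n" shows "inj_on (subst t) (words C d)"
proof (rule inj_onI)
  fix v w assume vw: "v \<in> words C d" "w \<in> words C d" "subst t v = subst t w"
  have "v ! j = w ! j" if "j < d" for j
  proof -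
    have "Inr j \<in> set t" using assms that by (auto simp: templates_def)
    then show ?thesis using vw(3) by (auto simp: subst_def dest!: bspec[of _ _ "Inr j"])
  qed
  then show "v = w" using vw by (intro nth_equalityI) (auto simp: words_def)
qed

text \<open>A uniform word over \<open>k + 1\<close> letters is a mixture of uniform words over \<open>k\<close> letters placed in
  subcubes, so the theorem for \<open>k\<close> letters finds a subspace over \<open>k\<close> letters inside an insensitive
  set; insensitivity then admits the last letter as a value of the variables.\<close>

lemma insensitive_contains_boxes:
  assumes density_hj: "\<forall>\<delta>>0. \<exists>n. density_hj k d \<delta> n" and "i < k" "0 < \<epsilon>"
  shows "\<exists>m c. 0 < c \<and> c \<le> 1 \<and> (\<forall>n E. insensitive i k E \<longrightarrow>
      \<epsilon> * real (Suc k) ^ (m + n) \<le> (\<Sum>w\<in>words {..<Suc k} (m + n). of_bool (w \<in> E)) \<longrightarrow>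
      (\<exists>t\<in>templates {..<Suc k} d m. c * real (Suc k) ^ n \<le>
        (\<Sum>y\<in>words {..<Suc k} n. of_bool (\<forall>v\<in>words {..<Suc k} d. subst t v @ y \<in> E))))"
proof -
  let ?K = "{..<Suc k}"
  \<comment> \<open>One half of \<epsilon> is lost in passing to a subcube, another in the
    pigeonhole.\<close>
  obtain l where l: "density_hj k d (\<epsilon> / 4) l" using density_hj[rule_format, of "\<epsilon> / 4"] assms(3) by auto
  obtain m where m: "\<And>B J f F. finite B \<Longrightarrow> card B = Suc k \<Longrightarrow> J \<subseteq> B \<Longrightarrow> card J = k \<Longrightarrow> 0 < F \<Longrightarrow>
    (\<And>z. 0 \<le> f z \<and> f z \<le> F) \<Longrightarrow> \<epsilon> * F * real (Suc k) ^ m \<le> (\<Sum>z\<in>words B m. f z) \<Longrightarrow>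
    \<exists>t\<in>templates B l m. \<epsilon> / 2 * F * real k ^ l \<le> (\<Sum>u\<in>words J l. f (subst t u))"
    using dense_subcube[of \<epsilon> k "Suc k" l] assms by (metis gr_zeroI less_nat_zero_code le_SucI le_refl)
  define P where "P = templates {..<k} d l"
  \<comment> \<open>The cap at 1 keeps \<open>1 - c / real (Suc k) ^ m\<close> nonnegative in the
    iteration below.\<close>
  define c where "c = min 1 (\<epsilon> / 4 / (real (card P) + 1))"
  show ?thesis
  proof (intro exI[of _ m] exI[of _ c] conjI allI impI)
    show "0 < c" "c \<le> 1" using assms by (auto simp: c_def)
    fix n E assume E: "insensitive i k E"
      and dense: "\<epsilon> * real (Suc k) ^ (m + n) \<le> (\<Sum>w\<in>words ?K (m + n). of_bool (w \<in> E))"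
    let ?f = "\<lambda>z. \<Sum>y\<in>words ?K n. of_bool (z @ y \<in> E) :: real"
    have "\<exists>t\<in>templates ?K l m. \<epsilon> / 2 * real (Suc k) ^ n * real k ^ l \<le>
        (\<Sum>u\<in>words {..<k} l. ?f (subst t u))"
    proof (rule m)
      show "0 \<le> ?f z \<and> ?f z \<le> real (Suc k) ^ n" for z
        using sum_bounded_above[of "words ?K n" "\<lambda>y. of_bool (z @ y \<in> E)" "1::real"]
        by (auto simp: card_words intro: sum_nonneg)
      show "\<epsilon> * real (Suc k) ^ n * real (Suc k) ^ m \<le> sum ?f (words ?K m)"
        using dense by (simp add: sum_words_append power_add algebra_simps)
    qed auto
    then obtain t where t: "t \<in> templates ?K l m"
      "\<epsilon> / 2 * real (Suc k) ^ n * real k ^ l \<le> (\<Sum>u\<in>words {..<k} l. ?f (subst t u))" by blast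
    have "card (words {..<k} l) \<noteq> 0" "card (words ?K n) \<noteq> 0" using assms by (simp_all add: card_words)
    then have ne: "words {..<k} l \<noteq> {}" "words ?K n \<noteq> {}" by auto
    obtain s where s: "s \<in> P" "\<epsilon> / 4 / (real (card P) + 1) * real (card (words ?K n)) \<le>
      (\<Sum>y\<in>words ?K n. of_bool (\<forall>u\<in>subst s ` words {..<k} d. subst t u @ y \<in> E))"
    proof (rule density_pigeonhole[of "words {..<k} l" "words ?K n" P "\<epsilon> / 4"
          "\<lambda>s. subst s ` words {..<k} d" "\<lambda>u y. subst t u @ y \<in> E"])
      show "\<exists>p\<in>P. subst p ` words {..<k} d \<subseteq> B"
        if "\<epsilon> / 4 * real (card (words {..<k} l)) \<le> (\<Sum>x\<in>words {..<k} l. of_bool (x \<in> B))" for B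
        using l that unfolding density_hj_def P_def by (force simp: card_words)
      show "2 * (\<epsilon> / 4) * real (card (words {..<k} l)) * real (card (words ?K n)) \<le>
          (\<Sum>u\<in>words {..<k} l. \<Sum>y\<in>words ?K n. of_bool (subst t u @ y \<in> E))"
        using t(2) by (simp add: card_words algebra_simps)
    qed (use assms(3) ne in \<open>auto simp: P_def\<close>)
    have sK: "s \<in> templates ?K d l"
      using s(1) templates_mono[of "{..<k}" ?K d l] by (auto simp: P_def)
    have t': "compose t s \<in> templates ?K d m" by (rule compose_templates[OF t(1) sK])
    have up: "subst (compose t s) v @ y \<in> E"
      if y: "\<forall>u\<in>subst s ` words {..<k} d. subst t u @ y \<in> E" and v: "v \<in> words ?K d" for y v
    proof -
      have "demote i k v \<in> words {..<k} d" using v assms by (simp add: demote_in_words)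
      then have "subst t (subst s (demote i k v)) @ y \<in> E" using y by blast
      then have "subst (compose t s) (demote i k v) @ y \<in> E" by (simp add: subst_compose[OF t(1) sK])
      moreover have "demote i k (subst (compose t s) v) = demote i k (subst (compose t s) (demote i k v))"
        using v by (intro demote_subst_cong[OF t']) (auto simp: words_def)
      ultimately show ?thesis using E unfolding insensitive_def by (metis demote_append)
    qed
    have "c * real (Suc k) ^ n \<le> \<epsilon> / 4 / (real (card P) + 1) * real (card (words ?K n))"
      unfolding c_def card_words[OF finite_lessThan] card_lessThan of_nat_power by (intro mult_right_mono) auto
    also note s(2)
    also have "(\<Sum>y\<in>words ?K n. of_bool (\<forall>u\<in>subst s ` words {..<k} d. subst t u @ y \<in> E)) \<le>
        (\<Sum>y\<in>words ?K n. of_bool (\<forall>v\<in>words ?K d. subst (compose t s) v @ y \<in> E) :: real)"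
      using up by (intro sum_mono) (auto simp: of_bool_def)
    finally show "\<exists>t\<in>templates ?K d m. c * real (Suc k) ^ n \<le>
        (\<Sum>y\<in>words ?K n. of_bool (\<forall>v\<in>words ?K d. subst t v @ y \<in> E))"
      using t' by blast
  qed
qed

text \<open>Instead of partitioning an insensitive set into subspaces, the following lemmas bound the sum
  over the set of any \<open>f \<le> 1\<close> whose average over each subspace is at most \<open>\<beta>\<close>. Each step removes a
  box \<open>V \<times> Y\<close>; what is left is no longer insensitive, but its sections \<open>E' x\<close> are.\<close>

lemma insensitive_sum_le_iterate:
  assumes c: "0 < c" "c \<le> 1" and "0 < \<epsilon>"
    and box: "\<forall>n E. insensitive i k E \<longrightarrow>
      \<epsilon> * real (Suc k) ^ (m + n) \<le> (\<Sum>w\<in>words {..<Suc k} (m + n). of_bool (w \<in> E)) \<longrightarrow>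
      (\<exists>t\<in>templates {..<Suc k} d m. c * real (Suc k) ^ n \<le>
        (\<Sum>y\<in>words {..<Suc k} n. of_bool (\<forall>v\<in>words {..<Suc k} d. subst t v @ y \<in> E)))"
  shows "\<exists>n. \<forall>E f \<beta>. insensitive i k E \<longrightarrow> (\<forall>w. f w \<le> (1::real)) \<longrightarrow> 0 \<le> \<beta> \<longrightarrow>
    (\<forall>t\<in>templates {..<Suc k} d n. (\<Sum>v\<in>words {..<Suc k} d. f (subst t v)) \<le> \<beta> * real (Suc k) ^ d) \<longrightarrow>
    (\<Sum>w\<in>words {..<Suc k} n. of_bool (w \<in> E) * f w) \<le>
      \<epsilon> * real (Suc k) ^ n + (\<beta> + (1 - c / real (Suc k) ^ m) ^ s) *
        (\<Sum>w\<in>words {..<Suc k} n. of_bool (w \<in> E))"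
proof (induction s)
  case 0
  show ?case
  proof (intro exI[of _ 0] allI impI)
    fix E :: "nat list set" and f :: "nat list \<Rightarrow> real" and \<beta> :: real
    assume "\<forall>w. f w \<le> 1" "0 \<le> \<beta>"
    then have "f [] \<le> 1" by blast
    then show "(\<Sum>w\<in>words {..<Suc k} 0. of_bool (w \<in> E) * f w) \<le>
      \<epsilon> * real (Suc k) ^ 0 + (\<beta> + (1 - c / real (Suc k) ^ m) ^ 0) *
        (\<Sum>w\<in>words {..<Suc k} 0. of_bool (w \<in> E))"
      using \<open>0 \<le> \<beta>\<close> \<open>0 < \<epsilon>\<close> by (auto simp: of_bool_def)
  qed
next
  case (Suc s)
  let ?K = "{..<Suc k}"
  define q where "q = real (Suc k)"
  define \<rho> where "\<rho> = 1 - c / q ^ m"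
  have q: "1 \<le> q" by (simp add: q_def)
  then have q': "1 \<le> q ^ j" for j by simp
  then have \<rho>: "0 \<le> \<rho>" using c q'[of m] unfolding \<rho>_def
    by (smt (verit) divide_le_eq_1)
  from Suc.IH obtain n where IH: "\<And>E f \<beta>. insensitive i k E \<Longrightarrow> (\<And>w. f w \<le> (1::real)) \<Longrightarrow> 0 \<le> \<beta> \<Longrightarrow>
    (\<And>t. t\<in>templates ?K d n \<Longrightarrow> (\<Sum>v\<in>words ?K d. f (subst t v)) \<le> \<beta> * q ^ d) \<Longrightarrow>
    (\<Sum>w\<in>words ?K n. of_bool (w \<in> E) * f w) \<le>
      \<epsilon> * q ^ n + (\<beta> + \<rho> ^ s) * (\<Sum>w\<in>words ?K n. of_bool (w \<in> E))"
    unfolding q_def \<rho>_def by blast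
  show ?case
    unfolding q_def[symmetric] \<rho>_def[symmetric]
  proof (intro exI[of _ "m + n"] allI impI)
    fix E :: "nat list set" and f :: "nat list \<Rightarrow> real" and \<beta> :: real
    assume E: "insensitive i k E" and f: "\<forall>w. f w \<le> 1" and \<beta>: "0 \<le> \<beta>"
      and sub: "\<forall>t\<in>templates ?K d (m + n). (\<Sum>v\<in>words ?K d. f (subst t v)) \<le> \<beta> * q ^ d"
    define e where "e = (\<Sum>w\<in>words ?K (m + n). of_bool (w \<in> E) :: real)"
    have e0: "0 \<le> e" unfolding e_def by (intro sum_nonneg) auto
    have e1: "e \<le> q ^ (m + n)"
      using sum_bounded_above[of "words ?K (m + n)" "\<lambda>w. of_bool (w \<in> E)" "1::real"]
      by (simp add: e_def card_words q_def)
    show "(\<Sum>w\<in>words ?K (m + n). of_bool (w \<in> E) * f w) \<le> \<epsilon> * q ^ (m + n) + (\<beta> + \<rho> ^ Suc s) *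
        (\<Sum>w\<in>words ?K (m + n). of_bool (w \<in> E))"
      unfolding e_def[symmetric]
    proof (cases "\<epsilon> * q ^ (m + n) \<le> e")
      \<comment> \<open>A sparse \<open>E\<close> is paid for by the \<epsilon> term, since
        \<open>f \<le> 1\<close>.\<close>
      case False
      have "(\<Sum>w\<in>words ?K (m + n). of_bool (w \<in> E) * f w) \<le> e"
        unfolding e_def using f by (intro sum_mono) (auto simp: of_bool_def)
      moreover have "0 \<le> (\<beta> + \<rho> ^ Suc s) * e" using \<beta> \<rho> e0 by (intro mult_nonneg_nonneg add_nonneg_nonneg) auto
      ultimately show "(\<Sum>w\<in>words ?K (m + n). of_bool (w \<in> E) * f w) \<le>
          \<epsilon> * q ^ (m + n) + (\<beta> + \<rho> ^ Suc s) * e" using False by linarith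
    next
      case True
      then obtain t where t: "t \<in> templates ?K d m" "c * q ^ n \<le>
        (\<Sum>y\<in>words ?K n. of_bool (\<forall>v\<in>words ?K d. subst t v @ y \<in> E))"
        using box[rule_format, OF E, of n] unfolding q_def e_def by blast
      define Y where "Y = {y. \<forall>v\<in>words ?K d. subst t v @ y \<in> E}"
      define V where "V = subst t ` words ?K d"
      \<comment> \<open>For fixed \<open>x\<close> the removed part is either all of
        \<open>Y\<close> or nothing, and \<open>Y\<close> is itself insensitive.\<close>
      define E' where "E' x = {y. x @ y \<in> E \<and> \<not> (x \<in> V \<and> y \<in> Y)}" for x
      define vy where "vy = q ^ d * (\<Sum>y\<in>words ?K n. of_bool (y \<in> Y))"
      define e' where "e' x = (\<Sum>y\<in>words ?K n. of_bool (y \<in> E' x) :: real)" for x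
      have V: "V \<subseteq> words ?K m" unfolding V_def using subst_in_words[OF t(1)] by blast
      have split: "of_bool (x @ y \<in> E) = of_bool (y \<in> E' x) + of_bool (x \<in> V) * (of_bool (y \<in> Y) :: real)" for x y
        unfolding E'_def Y_def V_def by (auto simp: of_bool_def)
      have sumV: "(\<Sum>x\<in>words ?K m. of_bool (x \<in> V) * h x) = (\<Sum>v\<in>words ?K d. h (subst t v))"
        for h :: "nat list \<Rightarrow> real"
      proof -
        have "(\<Sum>x\<in>words ?K m. of_bool (x \<in> V) * h x) = (\<Sum>x\<in>V. h x)"
          using V by (intro sum.mono_neutral_cong_right) auto
        also have "\<dots> = (\<Sum>v\<in>words ?K d. h (subst t v))"
          unfolding V_def using inj_on_subst[OF t(1)] by (simp add: sum.reindex)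
        finally show ?thesis .
      qed
      have dec: "(\<Sum>w\<in>words ?K (m + n). of_bool (w \<in> E) * h w) =
          (\<Sum>x\<in>words ?K m. \<Sum>y\<in>words ?K n. of_bool (y \<in> E' x) * h (x @ y)) +
          (\<Sum>y\<in>words ?K n. of_bool (y \<in> Y) * (\<Sum>v\<in>words ?K d. h (subst t v @ y)))"
        for h :: "nat list \<Rightarrow> real"
      proof -
        have "(\<Sum>w\<in>words ?K (m + n). of_bool (w \<in> E) * h w) =
          (\<Sum>x\<in>words ?K m. \<Sum>y\<in>words ?K n. of_bool (y \<in> E' x) * h (x @ y)) +
          (\<Sum>x\<in>words ?K m. \<Sum>y\<in>words ?K n. of_bool (x \<in> V) * (of_bool (y \<in> Y) * h (x @ y)))"
          unfolding sum_words_append split by (simp add: sum.distrib algebra_simps)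
        also have "(\<Sum>x\<in>words ?K m. \<Sum>y\<in>words ?K n. of_bool (x \<in> V) * (of_bool (y \<in> Y) * h (x @ y))) =
          (\<Sum>y\<in>words ?K n. \<Sum>x\<in>words ?K m. of_bool (x \<in> V) * (of_bool (y \<in> Y) * h (x @ y)))"
          by (rule sum.swap)
        also have "\<dots> = (\<Sum>y\<in>words ?K n. of_bool (y \<in> Y) * (\<Sum>v\<in>words ?K d. h (subst t v @ y)))"
          unfolding sumV by (simp add: sum_distrib_left)
        finally show ?thesis .
      qed
      have "(\<Sum>y\<in>words ?K n. of_bool (y \<in> Y) * (\<Sum>v\<in>words ?K d. 1)) = vy"
        by (simp add: vy_def card_words sum_distrib_left q_def mult.commute)
      then have e_eq: "e = (\<Sum>x\<in>words ?K m. e' x) + vy"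
        using dec[of "\<lambda>_. 1"] by (simp add: e_def e'_def)
      have "c * q ^ n \<le> (\<Sum>y\<in>words ?K n. of_bool (y \<in> Y))" using t(2) by (simp add: Y_def)
      also have "\<dots> \<le> vy" unfolding vy_def using q'[of d]
        by (intro mult_le_cancel_right1[THEN iffD2]) (auto intro: sum_nonneg)
      finally have vy: "c * q ^ n \<le> vy" .
      \<comment> \<open>The box takes up at least the fraction \<open>c / q ^ m\<close> of the whole
        cube, so removing it shrinks the mass of \<open>E\<close> at least by the factor
        \<rho>.\<close>
      have "c / q ^ m * e \<le> c / q ^ m * q ^ (m + n)" using e1 c q by (intro mult_left_mono) auto
      also have "\<dots> = c * q ^ n" using q by (simp add: power_add)
      finally have e': "(\<Sum>x\<in>words ?K m. e' x) \<le> \<rho> * e" using vy e_eq by (simp add: \<rho>_def algebra_simps)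
      have EE: "x @ v \<in> E \<longleftrightarrow> x @ w \<in> E" if "demote i k v = demote i k w" for x v w
        using E that unfolding insensitive_def by (metis demote_append)
      then have Y: "insensitive i k Y" unfolding insensitive_def Y_def by blast
      have IHx: "(\<Sum>y\<in>words ?K n. of_bool (y \<in> E' x) * f (x @ y)) \<le> \<epsilon> * q ^ n + (\<beta> + \<rho> ^ s) * e' x"
        if x: "x \<in> words ?K m" for x
        unfolding e'_def
      proof (rule IH)
        show "insensitive i k (E' x)" using EE Y unfolding insensitive_def E'_def by blast
        show "(\<Sum>v\<in>words ?K d. f (x @ subst r v)) \<le> \<beta> * q ^ d" if "r \<in> templates ?K d n" for r
          using bspec[OF sub Inl_append_templates[OF that x]] by simp
      qed (use f \<beta> in auto)
      \<comment> \<open>For fixed \<open>y\<close> the box is the subspace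
        \<open>t @ map Inl y\<close>, over which \<open>f\<close> averages at most \<beta>.\<close>
      have Yx: "(\<Sum>v\<in>words ?K d. f (subst t v @ y)) \<le> \<beta> * q ^ d" if "y \<in> words ?K n" for y
        using bspec[OF sub append_Inl_templates[OF t(1) that]] by simp
      have sumY: "(\<Sum>y\<in>words ?K n. of_bool (y \<in> Y) * (\<beta> * q ^ d)) = \<beta> * vy"
        unfolding vy_def by (subst sum_distrib_right[symmetric]) (simp only: mult_ac)
      have sumX: "(\<Sum>x\<in>words ?K m. \<epsilon> * q ^ n + (\<beta> + \<rho> ^ s) * e' x) =
          \<epsilon> * q ^ (m + n) + (\<beta> + \<rho> ^ s) * (\<Sum>x\<in>words ?K m. e' x)"
        by (simp add: sum.distrib card_words sum_distrib_left[symmetric] power_add q_def)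
      have "(\<Sum>w\<in>words ?K (m + n). of_bool (w \<in> E) * f w) \<le>
          (\<Sum>x\<in>words ?K m. \<epsilon> * q ^ n + (\<beta> + \<rho> ^ s) * e' x) +
          (\<Sum>y\<in>words ?K n. of_bool (y \<in> Y) * (\<beta> * q ^ d))"
        unfolding dec by (intro add_mono sum_mono IHx mult_left_mono Yx) auto
      also have "\<dots> = \<epsilon> * q ^ (m + n) + (\<beta> + \<rho> ^ s) * (\<Sum>x\<in>words ?K m. e' x) + \<beta> * vy"
        unfolding sumX sumY ..
      also have "\<dots> = \<epsilon> * q ^ (m + n) + \<beta> * e + \<rho> ^ s * (\<Sum>x\<in>words ?K m. e' x)"
        unfolding e_eq by (simp add: algebra_simps)
      also have "\<dots> \<le> \<epsilon> * q ^ (m + n) + \<beta> * e + \<rho> ^ s * (\<rho> * e)"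
        using e' \<rho> by (intro add_left_mono mult_left_mono) auto
      also have "\<dots> = \<epsilon> * q ^ (m + n) + (\<beta> + \<rho> ^ Suc s) * e" by (simp add: algebra_simps)
      finally show "(\<Sum>w\<in>words ?K (m + n). of_bool (w \<in> E) * f w) \<le>
          \<epsilon> * q ^ (m + n) + (\<beta> + \<rho> ^ Suc s) * e" .
    qed
  qed
qed

lemma insensitive_sum_le:
  assumes density_hj: "\<forall>\<delta>>0. \<exists>n. density_hj k d \<delta> n" and "i < k" "0 < \<epsilon>"
  shows "\<exists>n. \<forall>E f \<beta>. insensitive i k E \<longrightarrow> (\<forall>w. f w \<le> (1::real)) \<longrightarrow> 0 \<le> \<beta> \<longrightarrow>
    (\<forall>t\<in>templates {..<Suc k} d n.
      (\<Sum>v\<in>words {..<Suc k} d. f (subst t v)) \<le> \<beta> * real (Suc k) ^ d) \<longrightarrow>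
    (\<Sum>w\<in>words {..<Suc k} n. of_bool (w \<in> E) * f w) \<le> (\<beta> + \<epsilon>) * real (Suc k) ^ n"
proof -
  let ?K = "{..<Suc k}"
  have e2: "0 < \<epsilon> / 2" using assms by simp
  obtain m c where c: "0 < c" "c \<le> 1" and box: "\<forall>n E. insensitive i k E \<longrightarrow>
      \<epsilon> / 2 * real (Suc k) ^ (m + n) \<le> (\<Sum>w\<in>words ?K (m + n). of_bool (w \<in> E)) \<longrightarrow>
      (\<exists>t\<in>templates ?K d m. c * real (Suc k) ^ n \<le>
        (\<Sum>y\<in>words ?K n. of_bool (\<forall>v\<in>words ?K d. subst t v @ y \<in> E)))"
    using insensitive_contains_boxes[OF density_hj assms(2) e2] by blast
  define \<rho> where "\<rho> = 1 - c / real (Suc k) ^ m"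
  have "\<rho> < 1" using c by (simp add: \<rho>_def)
  \<comment> \<open>Each round shrinks the part not yet filled by subspaces by the factor \<rho>,
    apart from sparse remainders.\<close>
  then obtain s where s: "\<rho> ^ s < \<epsilon> / 2" using real_arch_pow_inv[OF e2] by blast
  obtain n where n: "\<And>E f \<beta>. insensitive i k E \<Longrightarrow> (\<And>w. f w \<le> (1::real)) \<Longrightarrow> 0 \<le> \<beta> \<Longrightarrow>
    (\<And>t. t\<in>templates ?K d n \<Longrightarrow> (\<Sum>v\<in>words ?K d. f (subst t v)) \<le> \<beta> * real (Suc k) ^ d) \<Longrightarrow>
    (\<Sum>w\<in>words ?K n. of_bool (w \<in> E) * f w) \<le>
      \<epsilon> / 2 * real (Suc k) ^ n + (\<beta> + \<rho> ^ s) * (\<Sum>w\<in>words ?K n. of_bool (w \<in> E))"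
    using insensitive_sum_le_iterate[where s = s, OF c e2 box] unfolding \<rho>_def by meson
  show ?thesis
  proof (intro exI[of _ n] allI impI)
    fix E and f :: "nat list \<Rightarrow> real" and \<beta> :: real
    assume *: "insensitive i k E" "\<forall>w. f w \<le> 1" "0 \<le> \<beta>" "\<forall>t\<in>templates {..<Suc k} d n.
      (\<Sum>v\<in>words {..<Suc k} d. f (subst t v)) \<le> \<beta> * real (Suc k) ^ d"
    define e where "e = (\<Sum>w\<in>words ?K n. of_bool (w \<in> E) :: real)"
    have e0: "0 \<le> e" unfolding e_def by (intro sum_nonneg) auto
    have e1: "e \<le> real (Suc k) ^ n"
      using sum_bounded_above[of "words ?K n" "\<lambda>w. of_bool (w \<in> E)" "1::real"]
      by (simp add: e_def card_words)
    have "(\<beta> + \<rho> ^ s) * e \<le> (\<beta> + \<epsilon> / 2) * e" using s e0 by (intro mult_right_mono) auto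
    also have "\<dots> \<le> (\<beta> + \<epsilon> / 2) * real (Suc k) ^ n" using e1 *(3) e2 by (intro mult_left_mono) auto
    finally show "(\<Sum>w\<in>words ?K n. of_bool (w \<in> E) * f w) \<le> (\<beta> + \<epsilon>) * real (Suc k) ^ n"
      using n[OF *(1) spec[OF *(2)] *(3) bspec[OF *(4)]] unfolding e_def by (simp add: algebra_simps)
  qed
qed

text \<open>Induction on the number of sets. The last set is filled by subspaces of dimension
  \<open>l\<close>, where \<open>l\<close> is so large that inside each of them the remaining sets,
  pulled back, can be filled by subspaces of dimension \<open>d\<close>. Thus the outer step is
  applied to \<open>f\<close> times the indicator of the first \<open>r\<close> sets, whose averages
  the inner step bounds.\<close>

lemma insensitive_Inter_sum_le:
  assumes density_hj: "\<And>d. \<forall>\<delta>>0. \<exists>n. density_hj k d \<delta> n" and "r \<le> k" "0 < \<epsilon>"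
  shows "\<exists>n. \<forall>E f \<beta>. (\<forall>j<r. insensitive j k (E j)) \<longrightarrow> (\<forall>w. f w \<le> (1::real)) \<longrightarrow> 0 \<le> \<beta> \<longrightarrow>
    (\<forall>t\<in>templates {..<Suc k} d n.
      (\<Sum>v\<in>words {..<Suc k} d. f (subst t v)) \<le> \<beta> * real (Suc k) ^ d) \<longrightarrow>
    (\<Sum>w\<in>words {..<Suc k} n. of_bool (\<forall>j<r. w \<in> E j) * f w) \<le> (\<beta> + \<epsilon>) * real (Suc k) ^ n"
  using assms(2,3)
proof (induction r arbitrary: \<epsilon>)
  case 0
  obtain t where t: "t \<in> templates {..<Suc k} d d" "\<And>v. v \<in> words {..<Suc k} d \<Longrightarrow> subst t v = v"
    using identity_template by blast
  show ?case
  proof (intro exI[of _ d] allI impI)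
    fix E :: "nat \<Rightarrow> nat list set" and f :: "nat list \<Rightarrow> real" and \<beta> :: real
    assume "\<forall>t\<in>templates {..<Suc k} d d.
      (\<Sum>v\<in>words {..<Suc k} d. f (subst t v)) \<le> \<beta> * real (Suc k) ^ d"
    from bspec[OF this t(1)] have "(\<Sum>v\<in>words {..<Suc k} d. f v) \<le> \<beta> * real (Suc k) ^ d"
      using t(2) by simp
    also have "\<dots> \<le> (\<beta> + \<epsilon>) * real (Suc k) ^ d" using 0 by (intro mult_right_mono) auto
    finally show "(\<Sum>w\<in>words {..<Suc k} d. of_bool (\<forall>j<0. w \<in> E j) * f w) \<le>
        (\<beta> + \<epsilon>) * real (Suc k) ^ d" by simp
  qed
next
  case (Suc r)
  let ?K = "{..<Suc k}"
  have e2: "0 < \<epsilon> / 2" using Suc.prems by simp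
  obtain l where l: "\<And>E f \<beta>. (\<And>j. j<r \<Longrightarrow> insensitive j k (E j)) \<Longrightarrow> (\<And>w. f w \<le> (1::real)) \<Longrightarrow> 0 \<le> \<beta> \<Longrightarrow>
    (\<And>t. t\<in>templates ?K d l \<Longrightarrow> (\<Sum>v\<in>words ?K d. f (subst t v)) \<le> \<beta> * real (Suc k) ^ d) \<Longrightarrow>
    (\<Sum>w\<in>words ?K l. of_bool (\<forall>j<r. w \<in> E j) * f w) \<le> (\<beta> + \<epsilon> / 2) * real (Suc k) ^ l"
    using Suc.IH[OF Suc_leD[OF Suc.prems(1)] e2] by meson
  obtain n where n: "\<And>E f \<beta>. insensitive r k E \<Longrightarrow> (\<And>w. f w \<le> (1::real)) \<Longrightarrow> 0 \<le> \<beta> \<Longrightarrow>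
    (\<And>t. t\<in>templates ?K l n \<Longrightarrow> (\<Sum>v\<in>words ?K l. f (subst t v)) \<le> \<beta> * real (Suc k) ^ l) \<Longrightarrow>
    (\<Sum>w\<in>words ?K n. of_bool (w \<in> E) * f w) \<le> (\<beta> + \<epsilon> / 2) * real (Suc k) ^ n"
    using insensitive_sum_le[OF density_hj Suc_le_lessD[OF Suc.prems(1)] e2, of l] by meson
  show ?case
  proof (intro exI[of _ n] allI impI)
    fix E :: "nat \<Rightarrow> nat list set" and f :: "nat list \<Rightarrow> real" and \<beta> :: real
    assume E: "\<forall>j<Suc r. insensitive j k (E j)" and f: "\<forall>w. f w \<le> 1" and \<beta>: "0 \<le> \<beta>"
      and sub: "\<forall>t\<in>templates ?K d n. (\<Sum>v\<in>words ?K d. f (subst t v)) \<le> \<beta> * real (Suc k) ^ d"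
    let ?g = "\<lambda>w. of_bool (\<forall>j<r. w \<in> E j) * f w"
    have "(\<Sum>w\<in>words ?K n. of_bool (w \<in> E r) * ?g w) \<le> (\<beta> + \<epsilon> / 2 + \<epsilon> / 2) * real (Suc k) ^ n"
    proof (rule n)
      fix t assume t: "t \<in> templates ?K l n"
      have "(\<Sum>v\<in>words ?K l. of_bool (\<forall>j<r. v \<in> {v. length v = l \<and> subst t v \<in> E j}) * f (subst t v)) \<le>
          (\<beta> + \<epsilon> / 2) * real (Suc k) ^ l"
      proof (rule l)
        show "(\<Sum>v\<in>words ?K d. f (subst t (subst s v))) \<le> \<beta> * real (Suc k) ^ d"
          if "s \<in> templates ?K d l" for s
          using bspec[OF sub compose_templates[OF t that]] by (simp add: subst_compose[OF t that])
      qed (use E f \<beta> t in \<open>auto intro: insensitive_subst\<close>)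
      also have "(\<Sum>v\<in>words ?K l. of_bool (\<forall>j<r. v \<in> {v. length v = l \<and> subst t v \<in> E j}) * f (subst t v)) =
          (\<Sum>v\<in>words ?K l. ?g (subst t v))"
        by (intro sum.cong) (auto simp: words_def of_bool_def)
      finally show "(\<Sum>v\<in>words ?K l. ?g (subst t v)) \<le> (\<beta> + \<epsilon> / 2) * real (Suc k) ^ l" .
    qed (use E f \<beta> e2 in \<open>auto simp: of_bool_def\<close>)
    also have "(\<Sum>w\<in>words ?K n. of_bool (w \<in> E r) * ?g w) =
        (\<Sum>w\<in>words ?K n. of_bool (\<forall>j<Suc r. w \<in> E j) * f w)"
      by (intro sum.cong) (auto simp: of_bool_def less_Suc_eq)
    also have "\<beta> + \<epsilon> / 2 + \<epsilon> / 2 = \<beta> + \<epsilon>" by simp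
    finally show "(\<Sum>w\<in>words ?K n. of_bool (\<forall>j<Suc r. w \<in> E j) * f w) \<le>
        (\<beta> + \<epsilon>) * real (Suc k) ^ n" .
  qed
qed

subsection \<open>The density increment\<close>

lemma sum_words_map:
  assumes "bij_betw g J K"
  shows "(\<Sum>u\<in>words J n. h (map g u)) = (\<Sum>v\<in>words K n. h v)"
proof (rule sum.reindex_bij_witness[where i = "map (inv_into J g)" and j = "map g"])
  have inj: "inj_on g J" and im: "g ` J = K" using assms by (auto simp: bij_betw_def)
  show "map (inv_into J g) (map g u) = u" if "u \<in> words J n" for u
    using that inj by (auto simp: words_def o_def subset_iff intro: map_idI)
  show "map g (map (inv_into J g) v) = v" if "v \<in> words K n" for v
    using that im by (auto simp: words_def o_def f_inv_into_f subset_iff intro: map_idI)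
  show "map (inv_into J g) v \<in> words J n" if "v \<in> words K n" for v
    using that im by (auto simp: words_def intro!: inv_into_into)
qed (use assms in \<open>auto simp: words_def bij_betw_def\<close>)

text \<open>The complement of an intersection is split by the first index that fails; each piece is
  again an intersection.\<close>

lemma of_bool_not_all:
  "of_bool (\<not> (\<forall>j<k. P j)) = (\<Sum>i<k. of_bool ((\<forall>j<i. P j) \<and> \<not> P i) :: real)" for k :: nat
proof (induction k)
  case (Suc k)
  have "of_bool (\<not> (\<forall>j<Suc k. P j)) =
      of_bool (\<not> (\<forall>j<k. P j)) + (of_bool ((\<forall>j<k. P j) \<and> \<not> P k) :: real)"
    by (auto simp: less_Suc_eq of_bool_def)
  then show ?case using Suc by simp
qed simp

text \<open>The letters \<open>k\<close> of \<open>x\<close> become the variable. The last point of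
  the line is \<open>x\<close> itself and the others are its demotions, so a line-free set that
  contains \<open>x\<close> misses one of them.\<close>

lemma line_template:
  assumes "x \<in> words {..<Suc k} n" "k \<in> set x"
  obtains t where "t \<in> templates {..<Suc k} 1 n" "\<And>i. subst t [i] = demote i k x"
proof
  let ?t = "map (\<lambda>a. if a = k then Inr 0 else Inl a) x :: (nat + nat) list"
  show "?t \<in> templates {..<Suc k} 1 n"
    using assms by (auto simp: templates_def words_def image_iff)
  show "subst ?t [i] = demote i k x" for i by (auto simp: subst_def demote_def)
qed

text \<open>All fixed letters are below \<open>k\<close>, so the letter \<open>k\<close> in the
  image marks exactly the variable positions.\<close>

lemma demote_subst_line:
  assumes "t \<in> templates {..<k} 1 n"
  shows "demote i k (subst t [k]) = subst t [i]"
proof -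
  have "(if case_sum id (nth [k]) z = k then i else case_sum id (nth [k]) z) = case_sum id (nth [i]) z"
    if "z \<in> set t" for z
  proof -
    have "z \<in> Inl ` {..<k} \<union> Inr ` {..<1}" using assms that by (auto simp: templates_def)
    then show ?thesis by auto
  qed
  then show ?thesis by (simp add: demote_def subst_def)
qed

lemma demote_map_nth:
  assumes "set c \<subseteq> {..<length w}"
  shows "demote i k (map (nth w) c) = map (nth (demote i k w)) c"
  using assms by (auto simp: demote_def)

lemma sum_of_bool_words_le:
  "(\<Sum>w\<in>words {..<K} n. of_bool (Q w)) \<le> real K ^ n"
  using sum_bounded_above[of "words {..<K} n" "\<lambda>w. of_bool (Q w)" "1::real"]
  by (simp add: card_words)

text \<open>Slices that cannot rise much above the average cannot make up for one that falls far
  below it.\<close>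

lemma sum_ge_slice:
  fixes s :: "'a \<Rightarrow> real"
  assumes "finite U" "u \<in> U" and up: "\<And>u. u \<in> U \<Longrightarrow> s u \<le> (D + \<gamma>) * F" and "0 \<le> \<gamma>" "0 \<le> F"
    and tot: "(D - \<gamma>) * real (card U) * F \<le> sum s U"
  shows "(D - 2 * \<gamma> * real (card U)) * F \<le> s u"
proof -
  have "0 < card U" using assms(1,2) by (auto simp: card_gt_0_iff)
  then have c: "real (card (U - {u})) = real (card U) - 1" using assms(1,2) by simp
  have "sum s U = s u + sum s (U - {u})" using assms(1,2) by (rule sum.remove)
  also have "sum s (U - {u}) \<le> real (card (U - {u})) * ((D + \<gamma>) * F)"
    using up by (intro sum_bounded_above) auto
  finally have "(D - \<gamma>) * real (card U) * F \<le> s u + (real (card U) - 1) * ((D + \<gamma>) * F)"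
    using tot c by simp
  moreover have "0 \<le> \<gamma> * F" using assms by simp
  ultimately show ?thesis by (simp add: algebra_simps)
qed

lemma density_hj_step:
  assumes "0 < k" and line: "\<forall>\<delta>>0. \<exists>n. density_hj k 1 \<delta> n"
  shows "\<forall>\<delta>>0. \<exists>n. density_hj (Suc k) 1 \<delta> n"
proof (rule ccontr)
  let ?K = "{..<Suc k}"
  define q where "q = real (Suc k)"
  have q: "1 \<le> q" by (simp add: q_def)
  then have qp: "0 < q ^ j" for j by simp
  define free where "free A n \<longleftrightarrow> \<not> (\<exists>t\<in>templates ?K 1 n. \<forall>v\<in>words ?K 1. subst t v \<in> A)" for A n
  define mass where "mass A n = (\<Sum>w\<in>words ?K n. of_bool (w \<in> A) :: real)" for A n
  \<comment> \<open>With \<open>D = Sup S\<close>, every dimension has line-free sets of density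
    almost \<open>D\<close> (\<open>lower\<close>), and for each tolerance some dimension has none
    noticeably denser (\<open>upper\<close>).\<close>
  define S where "S = {\<delta>. \<forall>n. \<exists>A. free A n \<and> \<delta> * q ^ n \<le> mass A n}"
  assume "\<not> (\<forall>\<delta>>0. \<exists>n. density_hj (Suc k) 1 \<delta> n)"
  then obtain \<delta>0 where "0 < \<delta>0" "\<And>n. \<not> density_hj (Suc k) 1 \<delta>0 n" by blast
  then have \<delta>0: "\<delta>0 \<in> S" unfolding S_def density_hj_def free_def mass_def q_def by blast
  have S1: "\<delta> \<le> 1" if S: "\<delta> \<in> S" for \<delta>
  proof -
    obtain A where "\<delta> * q ^ 0 \<le> mass A 0" using S unfolding S_def by blast
    also have "mass A 0 \<le> 1" unfolding mass_def by (simp add: of_bool_def del: sum_of_bool_eq)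
    finally show ?thesis by simp
  qed
  then have bdd: "bdd_above S" by (rule bdd_aboveI)
  define D where "D = Sup S"
  have D: "0 < D" "D \<le> 1"
    using cSup_upper[OF \<delta>0 bdd] \<open>0 < \<delta>0\<close> cSup_least[of S 1] \<delta>0 S1 by (auto simp: D_def)
  have lower: "\<exists>A. free A n \<and> (D - \<gamma>) * q ^ n \<le> mass A n" if \<gamma>: "0 < \<gamma>" for \<gamma> n
  proof -
    have "D - \<gamma> < D" "S \<noteq> {}" using \<gamma> \<delta>0 by auto
    then obtain \<delta> where \<delta>: "\<delta> \<in> S" "D - \<gamma> < \<delta>"
      using less_cSupD[of S "D - \<gamma>"] unfolding D_def by blast
    then obtain A where "free A n" "\<delta> * q ^ n \<le> mass A n" by (auto simp: S_def)
    moreover have "(D - \<gamma>) * q ^ n \<le> \<delta> * q ^ n" using \<delta> qp[of n] by (intro mult_right_mono) auto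
    ultimately show ?thesis by force
  qed
  have upper: "\<exists>n. \<forall>A. free A n \<longrightarrow> mass A n \<le> (D + \<gamma>) * q ^ n" if "0 < \<gamma>" for \<gamma>
  proof -
    have "D + \<gamma> \<notin> S" using cSup_upper[OF _ bdd, of "D + \<gamma>"] that by (auto simp: D_def)
    then show ?thesis unfolding S_def by (force simp: not_le intro: less_imp_le)
  qed
  obtain l where l: "density_hj k 1 (D / 4) l" using line[rule_format, of "D / 4"] D by auto
  define P where "P = templates {..<k} 1 l"
  \<comment> \<open>A line has positive length, so the label set \<open>B\<close> below has at least
    \<open>k + 1\<close> elements.\<close>
  have l0: "0 < l"
  proof -
    have "D / 4 * real k ^ l \<le> 1 * real k ^ l" using D by (intro mult_right_mono) auto
    also have "\<dots> = (\<Sum>w\<in>words {..<k} l. of_bool (w \<in> UNIV))" by (simp add: card_words)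
    finally obtain t where "t \<in> templates {..<k} 1 l" using l unfolding density_hj_def by blast
    then have "length t = l" "Inr 0 \<in> set t" by (auto simp: templates_def)
    then show ?thesis by auto
  qed
  \<comment> \<open>\<theta> is the proportion left by the pigeonhole and \<kappa> the resulting
    density increment. The complement will be cut into \<open>k\<close> pieces with a loss of
    \<open>2 * \<epsilon>\<close> on each, which makes two thirds of \<kappa> in all.\<close>
  define \<theta> where "\<theta> = D / 4 / (real (card P) + 1)"
  define \<kappa> where "\<kappa> = D * \<theta> / 4"
  define \<epsilon> where "\<epsilon> = \<kappa> / (3 * real k)"
  have \<theta>: "0 < \<theta>" using D by (simp add: \<theta>_def)
  have \<kappa>: "0 < \<kappa>" using D \<theta> by (simp add: \<kappa>_def)
  have \<epsilon>: "0 < \<epsilon>" using \<kappa> assms by (simp add: \<epsilon>_def)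
  \<comment> \<open>Dimensions are fixed from the inside out: \<open>d\<close> caps line-free sets,
    \<open>m\<close> allows filling by subspaces of dimension \<open>d\<close>, \<open>M\<close>
    yields a subcube of dimension \<open>m\<close>, and \<open>n\<close> comes last, with a
    tolerance that depends on \<open>N\<close>.\<close>
  obtain d where d: "\<And>A. free A d \<Longrightarrow> mass A d \<le> (D + \<epsilon>) * q ^ d" using upper[OF \<epsilon>] by blast
  obtain m where m: "\<And>E f \<beta>. (\<And>j. j<k \<Longrightarrow> insensitive j k (E j)) \<Longrightarrow> (\<And>w. f w \<le> (1::real)) \<Longrightarrow> 0 \<le> \<beta> \<Longrightarrow>
    (\<And>t. t\<in>templates ?K d m \<Longrightarrow> (\<Sum>v\<in>words ?K d. f (subst t v)) \<le> \<beta> * q ^ d) \<Longrightarrow>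
    (\<Sum>w\<in>words ?K m. of_bool (\<forall>j<k. w \<in> E j) * f w) \<le> (\<beta> + \<epsilon>) * q ^ m"
    using insensitive_Inter_sum_le[OF density_hj_multidim[OF line assms(1)] le_refl \<epsilon>, of d]
    unfolding q_def by meson
  define B where "B = {..<k + l}"
  obtain M where M: "\<And>J f F. J \<subseteq> B \<Longrightarrow> card J = Suc k \<Longrightarrow> 0 < F \<Longrightarrow>
    (\<And>z. 0 \<le> f z \<and> f z \<le> F) \<Longrightarrow> \<theta> * F * real (k + l) ^ M \<le> (\<Sum>z\<in>words B M. f z) \<Longrightarrow>
    \<exists>t\<in>templates B m M. \<theta> / 2 * F * q ^ m \<le> (\<Sum>u\<in>words J m. f (subst t u))"
  proof (rule dense_subcube[OF \<theta>, of "Suc k" "k + l" m])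
    show "Suc k \<le> k + l" using l0 by simp
  next
    fix M
    assume *: "\<And>B J f F. finite B \<Longrightarrow> card B = k + l \<Longrightarrow> J \<subseteq> B \<Longrightarrow> card J = Suc k \<Longrightarrow> 0 < F \<Longrightarrow>
    (\<And>z. 0 \<le> f z \<and> f z \<le> F) \<Longrightarrow> \<theta> * F * real (k + l) ^ M \<le> (\<Sum>z\<in>words B M. f z) \<Longrightarrow>
    \<exists>t\<in>templates B m M. \<theta> / 2 * F * real (Suc k) ^ m \<le> (\<Sum>u\<in>words J m. f (subst t u))"
    show thesis by (rule that[of M], unfold q_def, rule *) (auto simp: B_def)
  qed simp
  define N where "N = l + M"
  \<comment> \<open>The bound \<open>D / 2\<close> leaves every slice enough density for the
    pigeonhole, and the bound \<kappa> keeps the loss below the gain \<open>2 * \<kappa>\<close>. In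
    \<open>sum_ge_slice\<close> the tolerance \<gamma> is multiplied by \<open>2 * q ^ N\<close>,
    which gives \<eta>.\<close>
  define \<eta> where "\<eta> = min (D / 2) \<kappa>"
  define \<gamma> where "\<gamma> = \<eta> / (2 * q ^ N)"
  have \<eta>: "0 < \<eta>" "\<eta> \<le> D / 2" "\<eta> \<le> \<kappa>" using D \<kappa> by (auto simp: \<eta>_def)
  have \<gamma>: "0 < \<gamma>" using \<eta> qp[of N] by (simp add: \<gamma>_def)
  obtain n where n: "\<And>A. free A n \<Longrightarrow> mass A n \<le> (D + \<gamma>) * q ^ n" using upper[OF \<gamma>] by blast
  obtain A where A: "free A (N + n)" "(D - \<gamma>) * q ^ (N + n) \<le> mass A (N + n)"
    using lower[OF \<gamma>] by blast

  \<comment> \<open>Each slice is line-free in dimension \<open>n\<close>, hence of density at most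
    \<open>D + \<gamma>\<close>, while the average is at least \<open>D - \<gamma>\<close>.\<close>
  have slice: "(D - \<eta>) * q ^ n \<le> (\<Sum>y\<in>words ?K n. of_bool (u @ y \<in> A))" if u: "u \<in> words ?K N" for u
  proof -
    have up: "(\<Sum>y\<in>words ?K n. of_bool (x @ y \<in> A)) \<le> (D + \<gamma>) * q ^ n" if x: "x \<in> words ?K N" for x
    proof -
      have "free {y. x @ y \<in> A} n"
        using A(1) Inl_append_templates[OF _ x, of _ 1 n] unfolding free_def by fastforce
      then show ?thesis using n unfolding mass_def by fastforce
    qed
    have "(D - 2 * \<gamma> * real (card (words ?K N))) * q ^ n \<le> (\<Sum>y\<in>words ?K n. of_bool (u @ y \<in> A))"
    proof (rule sum_ge_slice[where U = "words ?K N"])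
      show "(D - \<gamma>) * real (card (words ?K N)) * q ^ n \<le>
          (\<Sum>x\<in>words ?K N. \<Sum>y\<in>words ?K n. of_bool (x @ y \<in> A))"
        using A(2) by (simp add: mass_def sum_words_append card_words power_add q_def mult.assoc)
    qed (use u up \<gamma> q in auto)
    also have "2 * \<gamma> * real (card (words ?K N)) = \<eta>" using qp[of N] by (simp add: \<gamma>_def card_words q_def)
    finally show ?thesis .
  qed

  \<comment> \<open>A template \<open>\<tau>\<close> of length \<open>l\<close> is blown up to length \<open>N\<close> by random labels \<open>c\<close>, each a position
    of \<open>[0..<k] @ w\<close>: the prefix \<open>[0..<k]\<close> makes every letter occur, so that the resulting word is a
    mixture of uniform points of subcubes; the unblown copy of \<open>w\<close> in front makes the letter \<open>k\<close>
    occur for certain.\<close>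
  define pull where "pull w c = w @ map (nth ([0..<k] @ w)) c" for w c
  have pull_words: "pull w c \<in> words ?K N" if "w \<in> words ?K l" "c \<in> words B M" for w c
  proof -
    have "([0..<k] @ w) ! j < Suc k" if "j < k + l" for j
      using that nth_words[OF \<open>w \<in> words ?K l\<close>, of "j - k"] by (auto simp: nth_append)
    then show ?thesis using that by (auto simp: pull_def words_def N_def B_def)
  qed
  have ne: "words {..<Suc j} i \<noteq> {}" for i j using card_words[of "{..<Suc j}" i] by auto
  have ne': "words {..<k} l \<noteq> {}" "words B M \<noteq> {}"
    using ne[of "k - 1" l] ne[of "k + l - 1" M] assms(1) by (auto simp: B_def)
  \<comment> \<open>Every slice has density at least \<open>D / 2\<close>, twice what
    \<open>l\<close> demands. So one line \<tau> over \<open>k\<close> letters is pulled into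
    \<open>A\<close> for a proportion \<theta> of the pairs of a label word and a tail.\<close>
  obtain \<tau> where \<tau>: "\<tau> \<in> P" "\<theta> * real (card (words B M \<times> words ?K n)) \<le>
      (\<Sum>cy\<in>words B M \<times> words ?K n.
        of_bool (\<forall>w\<in>subst \<tau> ` words {..<k} 1. pull w (fst cy) @ snd cy \<in> A))"
    unfolding \<theta>_def
  proof (rule density_pigeonhole[of "words {..<k} l" "words B M \<times> words ?K n" P "D / 4"
        "\<lambda>\<tau>. subst \<tau> ` words {..<k} 1" "\<lambda>w cy. pull w (fst cy) @ snd cy \<in> A"])
    show "\<exists>p\<in>P. subst p ` words {..<k} 1 \<subseteq> X"
      if "D / 4 * real (card (words {..<k} l)) \<le> (\<Sum>x\<in>words {..<k} l. of_bool (x \<in> X))" for X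
      using l that unfolding density_hj_def P_def by (force simp: card_words)
    have "2 * (D / 4) * real (card (words {..<k} l)) * real (card (words B M \<times> words ?K n)) =
        (\<Sum>w\<in>words {..<k} l. \<Sum>c\<in>words B M. D / 2 * q ^ n)"
      by (simp add: card_words card_cartesian_product q_def B_def)
    also have "\<dots> \<le> (\<Sum>w\<in>words {..<k} l. \<Sum>c\<in>words B M. \<Sum>y\<in>words ?K n. of_bool (pull w c @ y \<in> A))"
    proof (intro sum_mono)
      fix w c assume wc: "w \<in> words {..<k} l" "c \<in> words B M"
      then have "w \<in> words ?K l" using words_mono[of "{..<k}" ?K l] by auto
      from slice[OF pull_words[OF this wc(2)]]
      have "(D - \<eta>) * q ^ n \<le> (\<Sum>y\<in>words ?K n. of_bool (pull w c @ y \<in> A))" .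
      moreover have "D / 2 * q ^ n \<le> (D - \<eta>) * q ^ n" using \<eta> qp[of n] by (intro mult_right_mono) auto
      ultimately show "D / 2 * q ^ n \<le> (\<Sum>y\<in>words ?K n. of_bool (pull w c @ y \<in> A))" by linarith
    qed
    finally show "2 * (D / 4) * real (card (words {..<k} l)) * real (card (words B M \<times> words ?K n)) \<le>
        (\<Sum>w\<in>words {..<k} l. \<Sum>cy\<in>words B M \<times> words ?K n. of_bool (pull w (fst cy) @ snd cy \<in> A))"
      by (simp only: sum.cartesian_product case_prod_unfold fst_conv snd_conv)
  qed (use D ne ne' in \<open>auto simp: P_def B_def\<close>)

  \<comment> \<open>The extra point of \<tau> over \<open>k + 1\<close> letters; its demotions are
    the points over \<open>k\<close> letters.\<close>
  define w where "w = subst \<tau> [k]"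
  have \<tau>t: "\<tau> \<in> templates {..<k} 1 l" using \<tau> by (simp add: P_def)
  have wl: "length w = l" using \<tau>t by (simp add: w_def templates_def)
  have wK: "w \<in> words ?K l"
    unfolding w_def using \<tau>t templates_mono[of "{..<k}" ?K 1 l]
    by (intro subst_in_words[of \<tau>]) (auto simp: words_def)
  have dw: "demote i k w = subst \<tau> [i]" for i unfolding w_def by (rule demote_subst_line[OF \<tau>t])
  have "Inr 0 \<in> set \<tau>" using \<tau>t by (auto simp: templates_def)
  then have kw: "k \<in> set w" by (force simp: w_def subst_def intro!: image_eqI[where x = "Inr 0"])
  then obtain p where p: "p < l" "w ! p = k" using wl by (auto simp: in_set_conv_nth)
  define g where "g = nth ([0..<k] @ w)"
  \<comment> \<open>The labels below \<open>k\<close> name their own letter and \<open>k + p\<close>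
    names \<open>k\<close>, so uniform labels from \<open>J\<close> become uniform letters under
    \<open>g\<close>.\<close>
  define J where "J = insert (k + p) {..<k}"
  have J: "J \<subseteq> B" "card J = Suc k" using p by (auto simp: J_def B_def)
  have gk: "g (k + p) = k" "\<And>j. j < k \<Longrightarrow> g j = j" using p by (auto simp: g_def nth_append)
  have gbij: "bij_betw g J ?K"
    unfolding bij_betw_def
  proof
    show "inj_on g J" by (auto simp: J_def inj_on_def gk)
    show "g ` J = ?K" using gk by (auto simp: J_def image_iff less_Suc_eq)
  qed
  have gB: "g j < Suc k" if "j \<in> B" for j
    using that nth_words[OF wK, of "j - k"] by (auto simp: g_def B_def nth_append)

  \<comment> \<open>For a fixed tail \<open>y\<close>, the \<open>x\<close> with
    \<open>y \<in> D' x\<close> form the intersection of \<open>k\<close> sets, the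
    \<open>i\<close>-th insensitive to exchanging \<open>i\<close> and \<open>k\<close>.\<close>
  define D' where "D' x = {y. \<forall>i<k. demote i k x @ y \<in> A}" for x
  define f where "f c = (\<Sum>y\<in>words ?K n. of_bool (y \<in> D' (w @ map g c)) :: real)" for c
  have "\<exists>t\<in>templates B m M. \<theta> / 2 * q ^ n * q ^ m \<le> (\<Sum>u\<in>words J m. f (subst t u))"
  proof (rule M[OF J qp])
    show "0 \<le> f c \<and> f c \<le> q ^ n" for c
      using sum_of_bool_words_le[where K = "Suc k" and n = n and Q = "\<lambda>y. y \<in> D' (w @ map g c)"]
      unfolding f_def q_def by (auto intro: sum_nonneg)
    have "\<theta> * q ^ n * real (k + l) ^ M = \<theta> * real (card (words B M \<times> words ?K n))"
      by (simp add: card_words card_cartesian_product q_def B_def)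
    also note \<tau>(2)
    also have "(\<Sum>cy\<in>words B M \<times> words ?K n.
        of_bool (\<forall>w\<in>subst \<tau> ` words {..<k} 1. pull w (fst cy) @ snd cy \<in> A)) =
        (\<Sum>c\<in>words B M. \<Sum>y\<in>words ?K n.
        of_bool (\<forall>w\<in>subst \<tau> ` words {..<k} 1. pull w c @ y \<in> A))"
      by (simp only: sum.cartesian_product case_prod_unfold fst_conv snd_conv)
    also have "\<dots> \<le> (\<Sum>c\<in>words B M. f c)"
      unfolding f_def
    proof (intro sum_mono)
      fix c y assume c: "c \<in> words B M"
      have "demote i k (w @ map g c) = pull (subst \<tau> [i]) c" if "i < k" for i
      proof -
        have "demote i k [0..<k] = [0..<k]" by (auto simp: demote_def intro: map_idI)
        moreover have "set c \<subseteq> {..<length ([0..<k] @ w)}" using c wl by (auto simp: words_def B_def)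
        ultimately show ?thesis unfolding pull_def demote_append g_def
          by (subst demote_map_nth) (auto simp: dw)
      qed
      moreover have "[i] \<in> words {..<k} 1" if "i < k" for i using that by (auto simp: words_def)
      ultimately show "of_bool (\<forall>w\<in>subst \<tau> ` words {..<k} 1. pull w c @ y \<in> A) \<le>
          (of_bool (y \<in> D' (w @ map g c)) :: real)"
        unfolding D'_def by (auto simp: of_bool_def)
    qed
    finally show "\<theta> * q ^ n * real (k + l) ^ M \<le> (\<Sum>c\<in>words B M. f c)" .
  qed
  then obtain t where t: "t \<in> templates B m M"
    "\<theta> / 2 * q ^ n * q ^ m \<le> (\<Sum>u\<in>words J m. f (subst t u))" by blast
  \<comment> \<open>The subcube of label words, read through \<open>g\<close>, becomes a subspace of
    words of length \<open>N\<close> on which the intersection has density at least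
    \<open>\<theta> / 2\<close> on average over the tails.\<close>
  define T where "T = map Inl w @ map (map_sum g id) t"
  have "map (map_sum g id) t \<in> templates ?K m M"
  proof -
    have st: "set t \<subseteq> Inl ` B \<union> Inr ` {..<m}" "Inr ` {..<m} \<subseteq> set t" "length t = M"
      using t(1) by (auto simp: templates_def)
    have "map_sum g id z \<in> Inl ` ?K \<union> Inr ` {..<m}" if "z \<in> set t" for z
    proof -
      have "z \<in> Inl ` B \<union> Inr ` {..<m}" using that st by blast
      then show ?thesis using gB by auto
    qed
    moreover have "Inr j \<in> map_sum g id ` set t" if "j < m" for j
      using that st(2) by (force intro!: image_eqI[where x = "Inr j"])
    ultimately show ?thesis using st by (auto simp: templates_def)
  qed
  then have T: "T \<in> templates ?K m N" unfolding T_def N_def by (rule Inl_append_templates[OF _ wK])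
  have Tsub: "subst T (map g u) = w @ map g (subst t u)" if "u \<in> words J m" for u
  proof -
    have "case_sum id (nth (map g u)) (map_sum g id z) = g (case_sum id (nth u) z)" if "z \<in> set t" for z
    proof -
      have "z \<in> Inl ` B \<union> Inr ` {..<m}" using that t(1) by (auto simp: templates_def)
      then show ?thesis using length_words[OF \<open>u \<in> words J m\<close>] by auto
    qed
    then have "subst (map (map_sum g id) t) (map g u) = map g (subst t u)" by (simp add: subst_def)
    then show ?thesis by (simp add: T_def)
  qed
  have "(\<Sum>u\<in>words J m. f (subst t u)) =
      (\<Sum>u\<in>words J m. \<Sum>y\<in>words ?K n. of_bool (y \<in> D' (subst T (map g u))))"
    unfolding f_def by (intro sum.cong refl) (simp add: Tsub)
  also have "\<dots> = (\<Sum>v\<in>words ?K m. \<Sum>y\<in>words ?K n. of_bool (y \<in> D' (subst T v)))"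
    by (rule sum_words_map[OF gbij])
  finally have massD: "\<theta> / 2 * q ^ n * q ^ m \<le>
      (\<Sum>v\<in>words ?K m. \<Sum>y\<in>words ?K n. of_bool (y \<in> D' (subst T v)))" using t(2) by simp
  have "(\<Sum>v\<in>words ?K m. (D - \<eta>) * q ^ n) \<le> (\<Sum>v\<in>words ?K m. \<Sum>y\<in>words ?K n. of_bool (subst T v @ y \<in> A))"
    by (intro sum_mono slice subst_in_words[OF T])
  then have massA: "(D - \<eta>) * q ^ n * q ^ m \<le>
      (\<Sum>v\<in>words ?K m. \<Sum>y\<in>words ?K n. of_bool (subst T v @ y \<in> A))"
    by (simp add: card_words q_def mult_ac)

  \<comment> \<open>One tail must serve both \<open>A\<close> and the intersection. The combination
    \<open>a y + D * b y\<close> is averaged because its surplus over \<open>D * q ^ m\<close> is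
    the surplus of \<open>A\<close> over density \<open>D\<close> off the intersection.\<close>
  define a where "a y = (\<Sum>v\<in>words ?K m. of_bool (subst T v @ y \<in> A) :: real)" for y
  define b where "b y = (\<Sum>v\<in>words ?K m. of_bool (y \<in> D' (subst T v)) :: real)" for y
  have "(D - \<eta>) * q ^ n * q ^ m + D * (\<theta> / 2 * q ^ n * q ^ m) \<le>
      (\<Sum>y\<in>words ?K n. a y) + D * (\<Sum>y\<in>words ?K n. b y)"
    unfolding a_def b_def using massA massD D
    by (subst (1 2) sum.swap) (intro add_mono mult_left_mono, auto)
  then have tot: "(D - \<eta> + 2 * \<kappa>) * q ^ m * q ^ n \<le> (\<Sum>y\<in>words ?K n. a y + D * b y)"
    by (simp add: \<kappa>_def sum.distrib sum_distrib_left algebra_simps)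
  have pos: "0 < (D - \<eta> + 2 * \<kappa>) * q ^ m * q ^ n"
    using D \<eta> \<kappa> qp by (intro mult_pos_pos) auto
  obtain y where y: "y \<in> words ?K n" "(D - \<eta> + 2 * \<kappa>) * q ^ m * q ^ n / real (card (words ?K n)) \<le> a y + D * b y"
    using exists_ge_average[OF _ pos tot] by auto
  have "(D + \<kappa>) * q ^ m \<le> (D - \<eta> + 2 * \<kappa>) * q ^ m" using \<eta> qp[of m] by (intro mult_right_mono) auto
  also have "\<dots> = (D - \<eta> + 2 * \<kappa>) * q ^ m * q ^ n / real (card (words ?K n))"
    using q by (simp add: card_words q_def)
  finally have yb: "(D + \<kappa>) * q ^ m \<le> a y + D * b y" using y(2) by simp

  \<comment> \<open>\<open>A\<close> misses the intersection of the \<open>C j\<close> in the subspace \<open>T\<close>, hence exceeds density \<open>D\<close> on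
    its complement.\<close>
  define h where "h v = of_bool (subst T v @ y \<in> A) - D" for v
  define C where "C j = {v. length v = m \<and> subst T v \<in> {x. demote j k x @ y \<in> A}}" for j
  have C: "insensitive j k (C j)" for j
    unfolding C_def by (rule insensitive_subst[OF T]) (simp add: insensitive_def)
  have CD: "(\<forall>j<k. v \<in> C j) \<longleftrightarrow> y \<in> D' (subst T v)" if "v \<in> words ?K m" for v
    using that by (auto simp: C_def D'_def words_def)
  \<comment> \<open>Otherwise the point and its \<open>k\<close> demotions would form a line in
    \<open>A\<close>; it is a genuine line because the prefix \<open>w\<close> contains
    \<open>k\<close>.\<close>
  have disj: "subst T v @ y \<notin> A" if v: "v \<in> words ?K m" and "\<forall>j<k. v \<in> C j" for v
  proof
    assume in_A: "subst T v @ y \<in> A"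
    have "k \<in> set (subst T v)" using kw by (simp add: T_def)
    then obtain s where s: "s \<in> templates ?K 1 N" "\<And>i. subst s [i] = demote i k (subst T v)"
      using line_template[OF subst_in_words[OF T v]] by blast
    have "subst (s @ map Inl y) u \<in> A" if u: "u \<in> words ?K 1" for u
    proof -
      obtain i where i: "u = [i]" "i < Suc k" using u by (auto simp: words_def length_Suc_conv)
      show ?thesis
      proof (cases "i = k")
        case True
        then show ?thesis using in_A i s(2) by (simp add: demote_def)
      next
        case False
        then show ?thesis using i s(2) CD[OF v] \<open>\<forall>j<k. v \<in> C j\<close> by (simp add: D'_def)
      qed
    qed
    moreover have "s @ map Inl y \<in> templates ?K 1 (N + n)" by (rule append_Inl_templates[OF s(1) y(1)])
    ultimately show False using A(1) unfolding free_def by blast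
  qed
  have "a y - D * (q ^ m - b y) = (\<Sum>v\<in>words ?K m. of_bool (subst T v @ y \<in> A) - D * (1 - of_bool (y \<in> D' (subst T v))))"
    unfolding a_def b_def sum_subtractf sum_distrib_left[symmetric] by (simp add: card_words q_def)
  also have "\<dots> = (\<Sum>v\<in>words ?K m. of_bool (\<not> (\<forall>j<k. v \<in> C j)) * h v)"
  proof (intro sum.cong refl)
    fix v assume v: "v \<in> words ?K m"
    show "of_bool (subst T v @ y \<in> A) - D * (1 - of_bool (y \<in> D' (subst T v))) =
        of_bool (\<not> (\<forall>j<k. v \<in> C j)) * h v"
      using disj[OF v] CD[OF v] by (cases "y \<in> D' (subst T v)") (auto simp: h_def)
  qed
  finally have excess: "\<kappa> * q ^ m \<le> (\<Sum>v\<in>words ?K m. of_bool (\<not> (\<forall>j<k. v \<in> C j)) * h v)"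
    using yb by (simp add: algebra_simps)
  define G where "G v i = of_bool ((\<forall>j<i. v \<in> C j) \<and> v \<notin> C i) * h v" for v i
  have split: "of_bool (\<not> (\<forall>j<k. v \<in> C j)) * h v = (\<Sum>i<k. G v i)" for v
    unfolding G_def by (subst of_bool_not_all) (rule sum_distrib_right)
  have swap: "(\<Sum>v\<in>words ?K m. \<Sum>i<k. G v i) = (\<Sum>i<k. \<Sum>v\<in>words ?K m. G v i)"
    by (rule sum.swap)
  have excess': "\<kappa> * q ^ m \<le> (\<Sum>i<k. \<Sum>v\<in>words ?K m. G v i)"
    using excess by (simp only: split swap)
  have "(\<Sum>i<k. \<Sum>v\<in>words ?K m. G v i) \<le> (\<Sum>i<k. (\<epsilon> + \<epsilon>) * q ^ m)"
  proof (rule sum_mono)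
    fix i assume i: "i \<in> {..<k}"
    \<comment> \<open>The piece with first failing index \<open>i\<close>, padded by
      \<open>UNIV\<close> to an intersection of \<open>k\<close> sets.\<close>
    define E where "E j = (if j < i then C j else if j = i then - C j else UNIV)" for j
    have "(\<Sum>v\<in>words ?K m. of_bool (\<forall>j<k. v \<in> E j) * h v) \<le> (\<epsilon> + \<epsilon>) * q ^ m"
    proof (rule m[of E h \<epsilon>])
      show "insensitive j k (E j)" for j
      proof -
        have "insensitive j k (- C j)" using C[of j] unfolding insensitive_def by blast
        moreover have "insensitive j k UNIV" unfolding insensitive_def by blast
        ultimately show ?thesis unfolding E_def using C[of j] by presburger
      qed
      show "h v \<le> 1" for v using D by (simp add: h_def)
      show "(\<Sum>v\<in>words ?K d. h (subst s v)) \<le> \<epsilon> * q ^ d" if s: "s \<in> templates ?K d m" for s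
      proof -
        \<comment> \<open>In a subspace of \<open>T\<close> of dimension \<open>d\<close> the set
          \<open>A\<close> is still line-free, so the choice of \<open>d\<close> caps its density at
          \<open>D + \<epsilon>\<close> and the average of \<open>h\<close> at \<epsilon>.\<close>
        define A' where "A' = {v. subst (compose T s @ map Inl y) v \<in> A}"
        have cs: "compose T s @ map Inl y \<in> templates ?K d (N + n)"
          by (rule append_Inl_templates[OF compose_templates[OF T s] y(1)])
        have "free A' d"
          unfolding free_def
        proof
          assume "\<exists>r\<in>templates ?K 1 d. \<forall>v\<in>words ?K 1. subst r v \<in> A'"
          then obtain r where r: "r \<in> templates ?K 1 d" "\<forall>v\<in>words ?K 1. subst r v \<in> A'" by blast
          then have "\<forall>v\<in>words ?K 1. subst (compose (compose T s @ map Inl y) r) v \<in> A"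
            by (simp add: subst_compose[OF cs r(1)] A'_def)
          then show False using compose_templates[OF cs r(1)] A(1) unfolding free_def by blast
        qed
        then have "mass A' d \<le> (D + \<epsilon>) * q ^ d" by (rule d)
        moreover have "(\<Sum>v\<in>words ?K d. h (subst s v)) = mass A' d - D * q ^ d"
          by (simp add: h_def mass_def A'_def subst_compose[OF T s] sum_subtractf card_words q_def
              del: sum_of_bool_eq)
        ultimately show ?thesis by (simp add: algebra_simps)
      qed
    qed (use \<epsilon> in auto)
    moreover have "(\<forall>j<k. v \<in> E j) \<longleftrightarrow> (\<forall>j<i. v \<in> C j) \<and> v \<notin> C i" for v
      using i by (auto simp: E_def)
    ultimately show "(\<Sum>v\<in>words ?K m. G v i) \<le> (\<epsilon> + \<epsilon>) * q ^ m"
      unfolding G_def by (simp only:)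
  qed
  also have "\<dots> = 2 / 3 * (\<kappa> * q ^ m)" using assms(1) by (simp add: \<epsilon>_def)
  finally have "\<kappa> * q ^ m \<le> 2 / 3 * (\<kappa> * q ^ m)" using excess' by linarith
  moreover have "0 < \<kappa> * q ^ m" using \<kappa> qp[of m] by simp
  ultimately show False by linarith
qed

theorem density_hales_jewett:
  assumes "0 < k" "0 < \<delta>"
  shows "\<exists>n. density_hj k 1 \<delta> n"
proof -
  have "\<forall>\<delta>>0. \<exists>n. density_hj (Suc j) 1 \<delta> n" for j
  proof (induction j)
    case 0
    have "density_hj 1 1 \<delta> 1" if "0 < \<delta>" for \<delta>
      unfolding density_hj_def
    proof (intro allI impI)
      fix A :: "nat list set"
      have w: "words {..<1} 1 = {[0]}" by (auto simp: words_def length_Suc_conv)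
      assume "\<delta> * real 1 ^ 1 \<le> (\<Sum>w\<in>words {..<1} 1. of_bool (w \<in> A))"
      then have "[0] \<in> A" using that unfolding w by (cases "[0] \<in> A") auto
      then show "\<exists>t\<in>templates {..<1} 1 1. \<forall>v\<in>words {..<1} 1. subst t v \<in> A"
        unfolding w by (intro bexI[of _ "[Inr 0]"]) (auto simp: subst_def templates_def)
    qed
    then show ?case by auto
  next
    case (Suc j)
    then show ?case by (rule density_hj_step[OF zero_less_Suc])
  qed
  from this[of "k - 1"] show ?thesis using assms by auto
qed

subsection \<open>Fractional parts and Haar measure\<close>

lemma frac_add_frac_right: "frac (x + frac y) = frac (x + y)" for x y :: real
  by (simp add: frac_def algebra_simps)

text \<open>The projection to the torus: sums are formed in the real vector space and reduced once
  at the end.\<close>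

definition vfrac :: "real^'m \<Rightarrow> real^'m" where
  "vfrac x = (\<chi> i. frac (x $ i))"

lemma tadd_vfrac: "tadd (vfrac s) y = vfrac (s + y)"
  by (simp add: tadd_def vfrac_def vec_eq_iff frac_add_frac_right add.commute[of "frac _"] add.commute)

lemma frac_measurable [measurable]: "frac \<in> borel_measurable (borel :: real measure)"
  unfolding frac_def[abs_def] by measurable

lemma borel_measurable_vec_nth [measurable (raw)]:
  fixes f :: "'a \<Rightarrow> real^'m"
  shows "f \<in> borel_measurable M \<Longrightarrow> (\<lambda>x. f x $ i) \<in> borel_measurable M"
  by (rule measurable_compose[OF _ borel_measurable_nth])

lemma borel_measurable_vecI:
  fixes f :: "'a \<Rightarrow> real^'m"
  assumes "\<And>i. (\<lambda>x. f x $ i) \<in> borel_measurable M" shows "f \<in> borel_measurable M"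
  unfolding borel_measurable_euclidean_space[of f] using assms by (auto simp: Basis_vec_def inner_axis)

text \<open>\<open>A\<close> is cut at \<open>frac c\<close>: values above the cut are reached
  without wrapping round the circle, values below it after wrapping once, and both pieces are merely
  translated.\<close>

lemma nn_integral_frac_shift:
  assumes [measurable]: "A \<in> sets borel" and A: "A \<subseteq> {0..<1::real}"
  shows "(\<integral>\<^sup>+u. indicator {0..<1} u * indicator A (frac (u + c)) \<partial>lborel) = emeasure lborel A"
proof -
  define d where "d = frac c"
  have d: "0 \<le> d" "d < 1" by (auto simp: d_def frac_lt_1)
  have shift: "(\<integral>\<^sup>+u. indicator B (s + u) \<partial>lborel) = emeasure lborel B"
    if "B \<in> sets borel" for B :: "real set" and s
    using nn_integral_real_affine[of "indicator B" 1 s] that by simp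
  have "indicator {0..<1} u * indicator A (frac (u + c)) =
      indicator (A \<inter> {d..}) (d + u) + (indicator (A \<inter> {..<d}) (d - 1 + u) :: ennreal)" for u
  proof -
    have fc: "frac (u + c) = frac (u + d)" by (simp only: d_def frac_add_frac_right)
    consider "u < 0" | "0 \<le> u" "u + d < 1" | "u < 1" "1 \<le> u + d" | "1 \<le> u" using d by linarith
    then show ?thesis
    proof cases
      case 1
      then show ?thesis using A d by (auto simp: indicator_def)
    next
      case 2
      then have eq: "frac (u + d) = u + d" using d by (simp add: frac_eq)
      show ?thesis using 2 A d unfolding fc eq by (auto simp: indicator_def add.commute)
    next
      case 3
      then have eq: "frac (u + d) = u + d - 1" using d
        by (subst frac_unique_iff) (auto intro: Ints_1)
      show ?thesis using 3 A d unfolding fc eq by (auto simp: indicator_def algebra_simps)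
    next
      case 4
      then show ?thesis using A d by (auto simp: indicator_def)
    qed
  qed
  then have "(\<integral>\<^sup>+u. indicator {0..<1} u * indicator A (frac (u + c)) \<partial>lborel) =
      (\<integral>\<^sup>+u. indicator (A \<inter> {d..}) (d + u) + indicator (A \<inter> {..<d}) (d - 1 + u) \<partial>lborel)"
    by simp
  also have "\<dots> = (\<integral>\<^sup>+u. indicator (A \<inter> {d..}) (d + u) \<partial>lborel) +
      (\<integral>\<^sup>+u. indicator (A \<inter> {..<d}) (d - 1 + u) \<partial>lborel)"
    by (intro nn_integral_add) measurable
  also have "\<dots> = emeasure lborel (A \<inter> {d..}) + emeasure lborel (A \<inter> {..<d})"
    by (simp add: shift)
  also have "\<dots> = emeasure lborel (A \<inter> {d..} \<union> A \<inter> {..<d})"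
    by (intro plus_emeasure) auto
  also have "A \<inter> {d..} \<union> A \<inter> {..<d} = A" by auto
  finally show ?thesis .
qed

section \<open>The kernel on the torus and its Haar measure\<close>

locale haar_kernel =
  fixes L :: "real^'m^'r" and M :: "(real^'m) measure"
  assumes integer: "\<forall>j i. L$j$i \<in> \<int>"
    and invariant: "L *v (\<chi> i. 1) = 0"
    and haar: "haar_kerT L M"
begin

sublocale prob_space M
  using haar by (simp add: haar_kerT_def)

lemma sets_M [measurable_cong, simp]: "sets M = sets borel"
  using haar by (simp add: haar_kerT_def)

lemma space_M [simp]: "space M = UNIV"
  using sets_eq_imp_space_eq[OF sets_M] by simp

text \<open>The preimage of \<open>kerT L\<close> in the real vector space, where the group
  operation is ordinary addition.\<close>

definition solutions :: "(real^'m) set" where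
  "solutions = {x. \<forall>j. (L *v x) $ j \<in> \<int>}"

text \<open>Invariance of \<open>L\<close> enters here: translation along the diagonal stays in the
  kernel.\<close>

lemma const_solutions: "(\<chi> i. u) \<in> solutions"
proof -
  have "(\<chi> i. u) = u *\<^sub>R ((\<chi> i. 1) :: real^'m)" by (simp add: vec_eq_iff)
  then have "L *v (\<chi> i. u) = 0" using invariant by (simp add: matrix_vector_mult_scaleR)
  then show ?thesis by (simp add: solutions_def)
qed

lemma add_solutions: "x \<in> solutions \<Longrightarrow> y \<in> solutions \<Longrightarrow> x + y \<in> solutions"
  by (simp add: solutions_def matrix_vector_right_distrib)

lemma sum_solutions: "(\<And>j. j \<in> I \<Longrightarrow> x j \<in> solutions) \<Longrightarrow> sum x I \<in> solutions"
proof (induction I rule: infinite_finite_induct)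
  case (insert j I)
  then show ?case by (simp add: add_solutions)
qed (auto simp: solutions_def)

text \<open>Integrality of \<open>L\<close> enters here: dropping the integer parts changes
  \<open>L *v s\<close> by integers.\<close>

lemma vfrac_in_kerT:
  assumes "s \<in> solutions" shows "vfrac s \<in> kerT L"
proof -
  have "(L *v vfrac s) $ j = (L *v s) $ j - (\<Sum>i\<in>UNIV. L $ j $ i * of_int \<lfloor>s $ i\<rfloor>)" for j
    by (simp add: matrix_vector_mult_def vfrac_def frac_def algebra_simps sum_subtractf)
  moreover have "(\<Sum>i\<in>UNIV. L $ j $ i * of_int \<lfloor>s $ i\<rfloor>) \<in> \<int>" for j
    using integer by (intro Ints_sum Ints_mult) simp_all
  ultimately have "(L *v vfrac s) $ j \<in> \<int>" for j
    using assms by (simp add: solutions_def)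
  then show ?thesis by (auto simp: kerT_def torus_pts_def vfrac_def frac_lt_1)
qed

lemma solutions_measurable [measurable]: "solutions \<in> sets borel"
proof -
  have "solutions = (\<Inter>j. (\<lambda>x. (L *v x) $ j) -` \<int>)" by (auto simp: solutions_def)
  moreover have "closed ((\<lambda>x. (L *v x) $ j) -` \<int>)" for j
    by (intro closed_vimage closed_Ints continuous_intros)
  ultimately show ?thesis by (auto intro!: borel_closed closed_INT)
qed

lemma kerT_measurable [measurable]: "kerT L \<in> sets borel"
proof -
  have "kerT L = {x \<in> space borel. \<forall>i. 0 \<le> x $ i \<and> x $ i < 1} \<inter> solutions"
    by (auto simp: kerT_def torus_pts_def solutions_def)
  also have "\<dots> \<in> sets borel" by measurable
  finally show ?thesis .
qed

lemma AE_kerT: "AE x in M. x \<in> kerT L"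
proof (rule AE_I)
  show "emeasure M (UNIV - kerT L) = 0" using haar by (simp add: haar_kerT_def)
qed auto

lemma AE_solutions: "AE x in M. x \<in> solutions"
  using AE_kerT by eventually_elim (simp add: kerT_def solutions_def)

lemma nn_integral_shift:
  assumes "s \<in> solutions" and [measurable]: "f \<in> borel_measurable borel"
  shows "(\<integral>\<^sup>+y. f (vfrac (s + y)) \<partial>M) = (\<integral>\<^sup>+y. f y \<partial>M)"
proof -
  have "distr M borel (tadd (vfrac s)) = M"
    using haar vfrac_in_kerT[OF assms(1)] by (simp add: haar_kerT_def)
  then have "(\<integral>\<^sup>+y. f y \<partial>M) = (\<integral>\<^sup>+y. f y \<partial>distr M borel (tadd (vfrac s)))" by simp
  also have "\<dots> = (\<integral>\<^sup>+y. f (tadd (vfrac s) y) \<partial>M)"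
    by (intro nn_integral_distr borel_measurable_vecI) (simp_all add: tadd_def)
  finally show ?thesis by (simp add: tadd_vfrac)
qed

text \<open>A diagonal translation by \<open>u\<close> leaves the integral unchanged, so it may be
  averaged over \<open>u\<close> in \<open>{0..<1}\<close>. After exchanging the integrals, the
  inner one is a rotated copy of \<open>A\<close> for each fixed \<open>y\<close>.\<close>

lemma nn_integral_coordinate:
  assumes [measurable]: "A \<in> sets borel" and A: "A \<subseteq> {0..<1::real}"
  shows "(\<integral>\<^sup>+y. indicator A (frac (c + y $ i)) \<partial>M) = emeasure lborel A"
proof -
  interpret pair_sigma_finite lborel M ..
  have inner: "(\<integral>\<^sup>+y. indicator A (frac (u + (c + y $ i))) \<partial>M) = (\<integral>\<^sup>+y. indicator A (frac (c + y $ i)) \<partial>M)"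
    for u
    using nn_integral_shift[OF const_solutions[of u], of "\<lambda>y. indicator A (frac (c + y $ i))"]
    by (simp add: vfrac_def frac_add_frac_right algebra_simps)
  have "(\<integral>\<^sup>+y. indicator A (frac (c + y $ i)) \<partial>M) =
      (\<integral>\<^sup>+u. indicator {0..<1::real} u * (\<integral>\<^sup>+y. indicator A (frac (c + y $ i)) \<partial>M) \<partial>lborel)"
    by (subst nn_integral_multc) auto
  also have "\<dots> = (\<integral>\<^sup>+u. (\<integral>\<^sup>+y. indicator {0..<1} u * indicator A (frac (u + (c + y $ i))) \<partial>M) \<partial>lborel)"
    by (subst nn_integral_cmult) (auto simp: inner)
  also have "\<dots> = (\<integral>\<^sup>+y. (\<integral>\<^sup>+u. indicator {0..<1} u * indicator A (frac (u + (c + y $ i))) \<partial>lborel) \<partial>M)"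
    by (rule Fubini'[symmetric]) measurable
  also have "\<dots> = emeasure lborel A"
    by (simp add: nn_integral_frac_shift[OF assms] emeasure_space_1[simplified])
  finally show ?thesis .
qed

text \<open>Fubini with the factor \<open>j\<close> innermost: one independent draw fixes the
  distribution, whatever the others are. The others are almost surely solutions.\<close>

lemma nn_integral_PiM_const_section:
  assumes "finite I" "j \<notin> I" and f: "f \<in> borel_measurable (PiM (insert j I) (\<lambda>_. M))"
    and sec: "\<And>x. (\<And>i. i \<in> I \<Longrightarrow> x i \<in> solutions) \<Longrightarrow> (\<integral>\<^sup>+y. f (x(j := y)) \<partial>M) = c"
  shows "(\<integral>\<^sup>+Y. f Y \<partial>PiM (insert j I) (\<lambda>_. M)) = c"
proof -
  interpret product_sigma_finite "\<lambda>_. M" by standard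
  interpret I: prob_space "PiM I (\<lambda>_. M)" by (intro prob_space_PiM prob_space_axioms)
  have "AE x in PiM I (\<lambda>_. M). \<forall>i\<in>I. x i \<in> solutions"
    using assms(1) by (intro AE_finite_allI AE_PiM_component prob_space_axioms AE_solutions)
  then have "AE x in PiM I (\<lambda>_. M). (\<integral>\<^sup>+y. f (x(j := y)) \<partial>M) = c"
    by eventually_elim (use sec in auto)
  then have "(\<integral>\<^sup>+x. (\<integral>\<^sup>+y. f (x(j := y)) \<partial>M) \<partial>PiM I (\<lambda>_. M)) = (\<integral>\<^sup>+x. c \<partial>PiM I (\<lambda>_. M))"
    by (rule nn_integral_cong_AE)
  also have "\<dots> = c" by (simp add: I.emeasure_space_1)
  finally show ?thesis using product_nn_integral_insert[OF assms(1,2) f] by simp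
qed

section \<open>Random points attached to words\<close>

definition word_value :: "(nat \<Rightarrow> 'm) \<Rightarrow> nat \<Rightarrow> nat list \<Rightarrow> (nat \<Rightarrow> real^'m) \<Rightarrow> real" where
  "word_value e n w Y = frac (\<Sum>j<n. Y j $ e (w ! j))"

lemma word_value_measurable [measurable]:
  "word_value e n w \<in> borel_measurable (PiM {..<n} (\<lambda>_. M))"
  unfolding word_value_def[abs_def] by measurable

text \<open>With all draws but the first held fixed, the first alone makes the sum uniform on the
  circle.\<close>

lemma nn_integral_word_value:
  assumes [measurable]: "A \<in> sets borel" and A: "A \<subseteq> {0..<1::real}" and "0 < n"
  shows "(\<integral>\<^sup>+Y. indicator A (word_value e n w Y) \<partial>PiM {..<n} (\<lambda>_. M)) = emeasure lborel A"
proof -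
  have n: "{..<n} = insert 0 ({..<n} - {0})" using assms(3) by auto
  show ?thesis
  proof (subst n, rule nn_integral_PiM_const_section)
    show "(\<lambda>Y. indicator A (word_value e n w Y)) \<in> borel_measurable (PiM (insert 0 ({..<n} - {0})) (\<lambda>_. M))"
      unfolding n[symmetric] by measurable
    fix x :: "nat \<Rightarrow> real^'m"
    have "word_value e n w (x(0 := y)) = frac ((\<Sum>j\<in>{..<n} - {0}. x j $ e (w ! j)) + y $ e (w ! 0))" for y
      unfolding word_value_def using assms(3) by (subst sum.remove[of _ 0]) (auto simp: add.commute)
    then show "(\<integral>\<^sup>+y. indicator A (word_value e n w (x(0 := y))) \<partial>M) = emeasure lborel A"
      by (simp add: nn_integral_coordinate[OF assms(1,2)])
  qed auto
qed

text \<open>All draws are held fixed except one at a wildcard position \<open>p\<close>. Along the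
  line the others add up to a constant solution, by which the Haar point \<open>Y p\<close> is
  translated.\<close>

lemma nn_integral_line_value:
  fixes e :: "nat \<Rightarrow> 'm" and letter :: "'m \<Rightarrow> nat"
  assumes [measurable]: "S \<in> sets borel" and t: "t \<in> templates {..<k} 1 n"
    and e: "\<And>i. e (letter i) = i"
  shows "(\<integral>\<^sup>+Y. indicator S (\<chi> i. word_value e n (subst t [letter i]) Y) \<partial>PiM {..<n} (\<lambda>_. M)) = emeasure M S"
proof -
  have "Inr 0 \<in> set t" "length t = n" using t by (auto simp: templates_def)
  then obtain p where p: "p < n" "t ! p = Inr 0" by (auto simp: in_set_conv_nth)
  have n: "{..<n} = insert p ({..<n} - {p})" using p by auto
  have meas: "(\<lambda>Y. \<chi> i. word_value e n (subst t [letter i]) Y) \<in> borel_measurable (PiM {..<n} (\<lambda>_. M))"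
    by (rule borel_measurable_vecI) simp
  show ?thesis
  proof (subst n, rule nn_integral_PiM_const_section)
    show "(\<lambda>Y. indicator S (\<chi> i. word_value e n (subst t [letter i]) Y))
        \<in> borel_measurable (PiM (insert p ({..<n} - {p})) (\<lambda>_. M))"
      unfolding n[symmetric] using meas by measurable
    fix x :: "nat \<Rightarrow> real^'m" assume x: "\<And>j. j \<in> {..<n} - {p} \<Longrightarrow> x j \<in> solutions"
    \<comment> \<open>A fixed letter contributes the same number to every coordinate, a diagonal
      point; a wildcard contributes the whole draw.\<close>
    define s where "s = (\<Sum>j\<in>{..<n} - {p}. case t ! j of Inl b \<Rightarrow> (\<chi> i. x j $ e b) | Inr _ \<Rightarrow> x j)"
    have s: "s \<in> solutions"
      unfolding s_def using x by (intro sum_solutions) (auto split: sum.split intro: const_solutions)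
    have letter: "x j $ e (subst t [letter i] ! j) = (case t ! j of Inl b \<Rightarrow> (\<chi> i. x j $ e b) | Inr _ \<Rightarrow> x j) $ i"
      if "j < n" for i j
    proof -
      have "t ! j \<in> set t" using that \<open>length t = n\<close> by simp
      then have "t ! j \<in> Inl ` {..<k} \<union> Inr ` {..<1}" using t unfolding templates_def by blast
      then show ?thesis using that \<open>length t = n\<close> by (auto simp: subst_def e)
    qed
    have "word_value e n (subst t [letter i]) (x(p := y)) = frac ((s + y) $ i)" for i y
    proof -
      have "(\<Sum>j<n. (x(p := y)) j $ e (subst t [letter i] ! j)) =
          y $ e (subst t [letter i] ! p) + (\<Sum>j\<in>{..<n} - {p}. x j $ e (subst t [letter i] ! j))"
        using p(1) by (subst sum.remove[of _ p]) auto
      also have "y $ e (subst t [letter i] ! p) = y $ i"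
        using p \<open>length t = n\<close> by (simp add: subst_def e)
      also have "(\<Sum>j\<in>{..<n} - {p}. x j $ e (subst t [letter i] ! j)) = s $ i"
        unfolding s_def sum_component by (intro sum.cong refl letter) auto
      finally show ?thesis by (simp add: word_value_def add.commute)
    qed
    then have "(\<chi> i. word_value e n (subst t [letter i]) (x(p := y))) = vfrac (s + y)" for y
      by (simp add: vfrac_def vec_eq_iff)
    then show "(\<integral>\<^sup>+y. indicator S (\<chi> i. word_value e n (subst t [letter i]) (x(p := y))) \<partial>M) = emeasure M S"
      using nn_integral_shift[OF s, of "indicator S"] by simp
  qed auto
qed

lemma S_L_eq:
  assumes [measurable]: "A \<in> sets borel"
  shows "S_L M L A = measure M {x. \<forall>i. x $ i \<in> A}"
proof -
  have [measurable]: "{x. \<forall>i. x $ i \<in> A} \<in> sets borel"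
  proof -
    have "{x \<in> space borel. \<forall>i. (x :: real^'m) $ i \<in> A} \<in> sets borel" by measurable
    then show ?thesis by simp
  qed
  show ?thesis unfolding S_L_def
    using AE_kerT by (intro measure_eq_AE) (auto elim: eventually_mono)
qed

text \<open>The argument of \<open>density_pigeonhole\<close> with the draws in place of the second
  sum: for each \<open>Y\<close>, either the words sent to \<open>A\<close> have density below
  \<open>\<alpha> / 2\<close>, or some line is sent into \<open>A\<close>. In expectation each word
  counts \<open>measure lborel A\<close> and each line counts \<open>S_L M L A\<close>.\<close>

lemma S_L_ge:
  fixes e :: "nat \<Rightarrow> 'm" and letter :: "'m \<Rightarrow> nat"
  assumes A [measurable]: "A \<in> sets borel" and A01: "A \<subseteq> {0..<1}"
    and \<alpha>: "0 < \<alpha>" "\<alpha> \<le> measure lborel A"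
    and e: "\<And>i. e (letter i) = i" "\<And>i. letter i < k"
    and density_hj: "density_hj k 1 (\<alpha> / 2) n" and "0 < n" "0 < k"
  shows "\<alpha> / 2 / (real (card (templates {..<k} 1 n)) + 1) \<le> S_L M L A"
proof -
  define P where "P = PiM {..<n} (\<lambda>_. M)"
  define T where "T = templates {..<k} 1 n"
  interpret P: prob_space P unfolding P_def by (intro prob_space_PiM prob_space_axioms)
  define S where "S = {x :: real^'m. \<forall>i. x $ i \<in> A}"
  have S [measurable]: "S \<in> sets borel"
  proof -
    have "{x \<in> space borel. \<forall>i. (x :: real^'m) $ i \<in> A} \<in> sets borel" by measurable
    then show ?thesis by (simp add: S_def)
  qed
  define V where "V t Y = (\<chi> i. word_value e n (subst t [letter i]) Y)" for t Y
  have V [measurable]: "V t \<in> borel_measurable P" for t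
    unfolding P_def V_def[abs_def] by (rule borel_measurable_vecI) simp
  have W [measurable]: "word_value e n w \<in> borel_measurable P" for w
    unfolding P_def by measurable
  have W_int: "integrable P (\<lambda>Y. indicat_real A (word_value e n w Y))"
    and V_int: "integrable P (\<lambda>Y. indicat_real S (V t Y))" for w t
    by (intro P.integrable_const_bound[where B = 1]; simp)+
  have nn: "(\<integral>Y. indicat_real B (g Y) \<partial>P) = enn2real (\<integral>\<^sup>+Y. indicator B (g Y) \<partial>P)"
    if [measurable]: "g \<in> borel_measurable P" "B \<in> sets borel" for g :: "_ \<Rightarrow> 'z::topological_space" and B
    by (subst integral_eq_nn_integral) (auto simp: ennreal_indicator)
  have W_eq: "(\<integral>Y. indicat_real A (word_value e n w Y) \<partial>P) = measure lborel A" for w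
    using nn_integral_word_value[OF A A01 \<open>0 < n\<close>] by (simp add: nn measure_def P_def[symmetric])
  have V_eq: "(\<integral>Y. indicat_real S (V t Y) \<partial>P) = S_L M L A" if "t \<in> T" for t
    using nn_integral_line_value[OF S that[unfolded T_def] e(1)]
    by (simp add: nn measure_def P_def[symmetric] V_def[symmetric] S_L_eq[OF A] S_def[symmetric])
  have fin: "finite T" "finite (words {..<k} n)" by (auto simp: T_def)
  have pt: "(\<Sum>w\<in>words {..<k} n. indicat_real A (word_value e n w Y)) \<le>
      \<alpha> / 2 * real k ^ n + real k ^ n * (\<Sum>t\<in>T. indicat_real S (V t Y))" for Y
  proof (cases "\<alpha> / 2 * real k ^ n \<le> (\<Sum>w\<in>words {..<k} n. of_bool (w \<in> {w. word_value e n w Y \<in> A}))")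
    case True
    then obtain t where t: "t \<in> T" "\<forall>v\<in>words {..<k} 1. word_value e n (subst t v) Y \<in> A"
      using density_hj unfolding density_hj_def T_def by blast
    have "[letter i] \<in> words {..<k} 1" for i using e(2) by (simp add: words_def)
    then have "V t Y \<in> S" using t(2) by (simp add: V_def S_def)
    then have "1 \<le> (\<Sum>t\<in>T. of_bool (V t Y \<in> S) :: real)"
      by (intro of_bool_le_sum[where Q = "\<lambda>t. V t Y \<in> S", OF fin(1) t(1)])
    then have 1: "1 \<le> (\<Sum>t\<in>T. indicat_real S (V t Y))" by (simp add: indicator_def of_bool_def)
    have "(\<Sum>w\<in>words {..<k} n. indicat_real A (word_value e n w Y)) \<le> real k ^ n"
      using sum_bounded_above[of "words {..<k} n" "\<lambda>w. indicat_real A (word_value e n w Y)" 1]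
      by (simp add: card_words indicator_def)
    also have "\<dots> \<le> real k ^ n * (\<Sum>t\<in>T. indicat_real S (V t Y))"
      using mult_left_mono[OF 1, of "real k ^ n"] by simp
    finally show ?thesis using \<alpha> by (simp add: add_increasing)
  next
    case False
    moreover have "0 \<le> real k ^ n * (\<Sum>t\<in>T. indicat_real S (V t Y))"
      by (intro mult_nonneg_nonneg sum_nonneg) auto
    ultimately show ?thesis by (simp add: indicator_def of_bool_def)
  qed
  have "real k ^ n * measure lborel A = (\<integral>Y. (\<Sum>w\<in>words {..<k} n. indicat_real A (word_value e n w Y)) \<partial>P)"
    by (subst Bochner_Integration.integral_sum) (auto simp: W_int W_eq card_words)
  also have "\<dots> \<le> (\<integral>Y. \<alpha> / 2 * real k ^ n + real k ^ n * (\<Sum>t\<in>T. indicat_real S (V t Y)) \<partial>P)"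
    using W_int V_int pt by (intro integral_mono Bochner_Integration.integrable_sum
      Bochner_Integration.integrable_add integrable_mult_right P.integrable_const) auto
  also have "\<dots> = \<alpha> / 2 * real k ^ n + real k ^ n * (\<Sum>t\<in>T. \<integral>Y. indicat_real S (V t Y) \<partial>P)"
    using V_int by (subst Bochner_Integration.integral_add)
      (auto simp: P.prob_space intro!: Bochner_Integration.integrable_sum integrable_mult_right)
  also have "(\<Sum>t\<in>T. \<integral>Y. indicat_real S (V t Y) \<partial>P) = real (card T) * S_L M L A"
    using V_eq by simp
  finally have "real k ^ n * measure lborel A \<le> real k ^ n * (\<alpha> / 2 + real (card T) * S_L M L A)"
    by (simp add: algebra_simps)
  then have "measure lborel A \<le> \<alpha> / 2 + real (card T) * S_L M L A"
    using \<open>0 < k\<close> by (simp only: mult_le_cancel_left_pos zero_less_power of_nat_0_less_iff)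
  then have "\<alpha> / 2 \<le> real (card T) * S_L M L A" using \<alpha> by linarith
  also have "\<dots> \<le> (real (card T) + 1) * S_L M L A"
    by (intro mult_right_mono) (auto simp: S_L_def)
  finally show ?thesis unfolding T_def[symmetric] by (simp add: field_simps)
qed

end

theorem theorem1p4:
  fixes L :: "real^'m^'r"
  assumes integer: "\<forall>j i. L$j$i \<in> \<int>"
    and invariant: "L *v (\<chi> i. 1) = 0"
    and full_rank: "rank L = CARD('r)"
  shows "\<forall>\<alpha>>0. \<exists>c>0. \<forall>M A. haar_kerT L M \<longrightarrow> A \<in> sets borel \<longrightarrow> A \<subseteq> {0..<1}
           \<longrightarrow> measure lborel A \<ge> \<alpha> \<longrightarrow> S_L M L A \<ge> c"
proof (intro allI impI)
  fix \<alpha> :: real assume "0 < \<alpha>"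
  define k where "k = CARD('m)"
  have k: "0 < k" by (simp add: k_def)
  obtain e :: "nat \<Rightarrow> 'm" where e: "bij_betw e {0..<k} UNIV"
    using ex_bij_betw_nat_finite[of "UNIV :: 'm set"] by (auto simp: k_def)
  define letter where "letter = inv_into {0..<k} e"
  have letter: "e (letter i) = i" "letter i < k" for i
    using bij_betw_inv_into_right[OF e, of i] bij_betw_apply[OF bij_betw_inv_into[OF e], of i]
    by (auto simp: letter_def)
  \<comment> \<open>With density at most 1 the full cube counts as dense. This excludes
    \<open>n = 0\<close> below, since no line has length 0.\<close>
  define \<beta> where "\<beta> = min \<alpha> 1"
  have \<beta>: "0 < \<beta>" "\<beta> \<le> 1" "\<beta> \<le> \<alpha>" using \<open>0 < \<alpha>\<close> by (auto simp: \<beta>_def)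
  obtain n where n: "density_hj k 1 (\<beta> / 2) n" using density_hales_jewett[OF k, of "\<beta> / 2"] \<beta> by auto
  have "0 < n"
  proof (rule ccontr)
    assume "\<not> 0 < n"
    then have "\<exists>t. t \<in> templates {..<k} 1 0"
      using n[unfolded density_hj_def, rule_format, of UNIV] \<beta> by auto
    then show False by (auto simp: templates_def)
  qed
  show "\<exists>c>0. \<forall>M A. haar_kerT L M \<longrightarrow> A \<in> sets borel \<longrightarrow> A \<subseteq> {0..<1}
           \<longrightarrow> measure lborel A \<ge> \<alpha> \<longrightarrow> S_L M L A \<ge> c"
  proof (intro exI[of _ "\<beta> / 2 / (real (card (templates {..<k} 1 n)) + 1)"] conjI allI impI)
    show "0 < \<beta> / 2 / (real (card (templates {..<k} 1 n)) + 1)" using \<beta> by simp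
    fix M :: "(real^'m) measure" and A :: "real set"
    assume *: "haar_kerT L M" "A \<in> sets borel" "A \<subseteq> {0..<1}" "\<alpha> \<le> measure lborel A"
    interpret haar_kernel L M using integer invariant *(1) by unfold_locales
    show "\<beta> / 2 / (real (card (templates {..<k} 1 n)) + 1) \<le> S_L M L A"
      using * \<beta> by (intro S_L_ge[OF _ _ _ _ letter n \<open>0 < n\<close> k]) auto
  qed
qed

end
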